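(* Let $(T,\mathcal{A},\mu)$ be a complete finite measure space. (a) Let $\Phi:T\times\mathbb{R}^n\rightrightarrows\mathbb{R}^m$ be a set-valued normal integrand and assume that $\mu$ is nonatomic. Then, given any $(\bar x,\bar y)\in\operatorname{gph}E_\Phi$ and $\bar{\mathsf y}\in\mathcal{S}_\Phi(\bar x,\bar y)$, the mapping $\Phi$ is integrably quasi-Lipschitzian around $(\bar x,\bar{\mathsf y})$ if and only if it is integrably locally Lipschitzian around $\bar x$. (b) Conversely, if $T$ contains at least one atom, then there exist a set-valued normal integrand $\Phi:T\times\mathbb{R}^n\rightrightarrows\mathbb{R}^m$, a pair $(\bar x,\bar y)\in\operatorname{gph}E_\Phi$ and $\bar{\mathsf y}\in\mathcal{S}_\Phi(\bar x,\bar y)$ such that $\Phi$ is integrably quasi-Lipschitzian around $(\bar x,\bar{\mathsf y})$ but not integrably locally Lipschitzian around $\bar x$.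
   Context: $\mathbb{R}_+:=\{\alpha\in\mathbb{R}:\alpha>0\}$; $L^p(T,\cdot)$ are the usual Lebesgue spaces; vectors are identified with constant functions; $\mathbb{B}_r(\cdot)$ is the closed ball, $\mathbb{B}$ the closed unit ball; $n,m\in\mathbb{N}$. For $\Phi:T\times\mathbb{R}^n\rightrightarrows\mathbb{R}^m$ write $\Phi_t:=\Phi(t,\cdot)$. $\Phi$ is a set-valued normal integrand if $\operatorname{gph}\Phi_t$ is closed for all $t\in T$ and $\operatorname{gph}\Phi\in\mathcal{A}\otimes\mathcal{B}(\mathbb{R}^n\times\mathbb{R}^m)$. $E_\Phi(x):=\int_T\Phi_t(x)d\mu=\{\int_T\mathsf{y}\,d\mu:\mathsf{y}\in L^1(T,\mathbb{R}^m),\ \mathsf{y}(t)\in\Phi_t(x)\text{ a.e.}\}$ (Aumann integral). $\mathcal{S}_\Phi(x,y):=\{\mathsf{y}\in L^1(T,\mathbb{R}^m):\int_T\mathsf{y}\,d\mu=y,\ \mathsf{y}(t)\in\Phi_t(x)\text{ for a.e. }t\}$. An atom is a set $A\in\mathcal{A}$ with $\mu(A)>0$ such that every $B\in\mathcal{A}$, $B\subset A$, $\mu(B)<\mu(A)$ has $\mu(B)=0$; $\mu$ is nonatomic if there are no atoms. Integrably locally Lipschitzian around $\bar x$: there exist $\eta>0$, $\ell\in L^1(T,\mathbb{R}_+)$ and $\hat T\in\mathcal{A}$ with $\mu(T\setminus\hat T)=0$ such that $\Phi_t(x)\subset\Phi_t(x')+\ell(t)\|x-x'\|\mathbb{B}$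 for all $t\in\hat T$ and $x,x'\in\mathbb{B}_\eta(\bar x)$. Regular normal cone: $\hat N(\bar z;\Omega)=\{z^*:\limsup_{z\to\bar z,z\in\Omega}\langle z^*,z-\bar z\rangle/\|z-\bar z\|\le0\}$ for $\bar z\in\Omega$, $\emptyset$ otherwise. Limiting normal cone: $N(\bar z;\Omega)=\{z^*:\exists z_k\to\bar z,\ z_k^*\to z^*,\ z_k^*\in\hat N(z_k;\Omega)\}$. Limiting coderivative at $(x,y)\in\operatorname{gph}G$: $D^*G(x,y)(y^* )=\{x^*:(x^*,-y^* )\in N((x,y);\operatorname{gph}G)\}$. $\Phi$ is integrably quasi-Lipschitzian around $(\bar x,\bar{\mathsf y})$ if there exist $\eta>0$ and $\ell\in L^1(T,\mathbb{R}_+)$ such that $\sup\{\|x^*\|:x^*\in D^*\Phi_t(\mathsf{x}(t),\mathsf{y}(t))(\mathsf{y}^*(t))\}\le\ell(t)\|\mathsf{y}^*(t)\|$ for a.e. $t\in T$ whenever $\mathsf{x}\in L^\infty(T,\mathbb{R}^n)$ with $\|\mathsf{x}-\bar x\|_\infty\le\eta$, $\mathsf{y}\in L^1(T,\mathbb{R}^m)$ with $\|\mathsf{y}-\bar{\mathsf y}\|_1\le\eta$ and $\mathsf{y}(t)\in\Phi_t(\mathsf{x}(t))$ a.e., and $\mathsf{y}^*\in L^\infty(T,\mathbb{R}^m)$ (the inequality being regarded as satisfied when the set is empty). *)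

theory Defs
  imports "HOL-Probability.Essential_Supremum"
begin

section \<open>Atoms\<close>

definition is_atom :: "'t measure \<Rightarrow> 't set \<Rightarrow> bool" where
  "is_atom M A \<longleftrightarrow> A \<in> sets M \<and> emeasure M A > 0 \<and>
     (\<forall>B\<in>sets M. B \<subseteq> A \<and> emeasure M B < emeasure M A \<longrightarrow> emeasure M B = 0)"

definition nonatomic :: "'t measure \<Rightarrow> bool" where
  "nonatomic M \<longleftrightarrow> \<not> (\<exists>A. is_atom M A)"

section \<open>Lebesgue spaces\<close>

text \<open>Elements of the Lebesgue spaces are represented by functions rather than by equivalence
  classes; the notions defined below do not distinguish functions that agree almost everywhere.
  The norm in \<open>L\<^sup>\<infinity>\<close> is extended-real-valued because the essential supremum of the library
  requires a complete linear order. Membership in \<open>L\<^sup>1\<close> is \<^term>\<open>integrable M\<close>.\<close>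

definition Linf_norm :: "'t measure \<Rightarrow> ('t \<Rightarrow> 'a::{second_countable_topology, real_normed_vector}) \<Rightarrow> ereal" where
  "Linf_norm M f = esssup M (\<lambda>t. ereal (norm (f t)))"

definition Linf :: "'t measure \<Rightarrow> ('t \<Rightarrow> 'a::{second_countable_topology, real_normed_vector}) set" where
  "Linf M = {f \<in> borel_measurable M. Linf_norm M f < \<infinity>}"

definition L1_norm :: "'t measure \<Rightarrow> ('t \<Rightarrow> 'a::{second_countable_topology, banach}) \<Rightarrow> real" where
  "L1_norm M f = (\<integral>t. norm (f t) \<partial>M)"

definition L1_pos :: "'t measure \<Rightarrow> ('t \<Rightarrow> real) set" where
  "L1_pos M = {l. integrable M l \<and> (\<forall>t\<in>space M. l t > 0)}"

section \<open>Normal cones and coderivatives\<close>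

definition gph :: "('x \<Rightarrow> 'y set) \<Rightarrow> ('x \<times> 'y) set" where
  "gph G = {(x, y). y \<in> G x}"

text \<open>The filter \<^term>\<open>at zb within W\<close> excludes \<open>zb\<close>; at an isolated point of \<open>W\<close> it is trivial,
  the upper limit is \<open>-\<infinity>\<close>, and every vector is a regular normal.\<close>

definition regular_normal_cone :: "'a::real_inner \<Rightarrow> 'a set \<Rightarrow> 'a set" where
  "regular_normal_cone zb W = (if zb \<in> W
     then {zs. Limsup (at zb within W) (\<lambda>z. ereal (inner zs (z - zb) / norm (z - zb))) \<le> 0}
     else {})"

definition limiting_normal_cone :: "'a::real_inner \<Rightarrow> 'a set \<Rightarrow> 'a set" where
  "limiting_normal_cone zb W = {zs. \<exists>z zss. z \<longlonglongrightarrow> zb \<and> zss \<longlonglongrightarrow> zs \<and>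
     (\<forall>k::nat. zss k \<in> regular_normal_cone (z k) W)}"

definition coderivative :: "('x::real_inner \<Rightarrow> 'y::real_inner set) \<Rightarrow> 'x \<times> 'y \<Rightarrow> 'y \<Rightarrow> 'x set" where
  "coderivative G z ys = {xs. (xs, - ys) \<in> limiting_normal_cone z (gph G)}"

section \<open>Set-valued integrands and their integrals\<close>

definition set_valued_normal_integrand ::
    "'t measure \<Rightarrow> ('t \<Rightarrow> 'x::euclidean_space \<Rightarrow> 'y::euclidean_space set) \<Rightarrow> bool" where
  "set_valued_normal_integrand M \<Phi> \<longleftrightarrow>
     (\<forall>t\<in>space M. closed (gph (\<Phi> t))) \<and>
     {(t, x, y). t \<in> space M \<and> y \<in> \<Phi> t x} \<in> sets (M \<Otimes>\<^sub>M (borel :: ('x \<times> 'y) measure))"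

definition aumann_integral ::
    "'t measure \<Rightarrow> ('t \<Rightarrow> 'x \<Rightarrow> 'y::euclidean_space set) \<Rightarrow> 'x \<Rightarrow> 'y set" where
  "aumann_integral M \<Phi> x = {(\<integral>t. y t \<partial>M) | y. integrable M y \<and> (AE t in M. y t \<in> \<Phi> t x)}"

definition integrable_selections ::
    "'t measure \<Rightarrow> ('t \<Rightarrow> 'x \<Rightarrow> 'y::euclidean_space set) \<Rightarrow> 'x \<Rightarrow> 'y \<Rightarrow> ('t \<Rightarrow> 'y) set" where
  "integrable_selections M \<Phi> x yv =
     {y. integrable M y \<and> (\<integral>t. y t \<partial>M) = yv \<and> (AE t in M. y t \<in> \<Phi> t x)}"

section \<open>Integrable Lipschitzian properties\<close>

definition integrably_locally_Lipschitzian ::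
    "'t measure \<Rightarrow> ('t \<Rightarrow> 'x::euclidean_space \<Rightarrow> 'y::euclidean_space set) \<Rightarrow> 'x \<Rightarrow> bool" where
  "integrably_locally_Lipschitzian M \<Phi> xb \<longleftrightarrow>
     (\<exists>\<eta>>0. \<exists>l\<in>L1_pos M. \<exists>T'\<in>sets M. emeasure M (space M - T') = 0 \<and>
       (\<forall>t\<in>T'. \<forall>x\<in>cball xb \<eta>. \<forall>x'\<in>cball xb \<eta>.
          \<Phi> t x \<subseteq> {y + (l t * norm (x - x')) *\<^sub>R b | y b. y \<in> \<Phi> t x' \<and> b \<in> cball 0 1}))"

text \<open>The supremum is taken in the extended reals, so that it is \<open>-\<infinity>\<close> for the empty set and the
  inequality then holds.\<close>

definition integrably_quasi_Lipschitzian ::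
    "'t measure \<Rightarrow> ('t \<Rightarrow> 'x::euclidean_space \<Rightarrow> 'y::euclidean_space set) \<Rightarrow> 'x \<Rightarrow> ('t \<Rightarrow> 'y) \<Rightarrow> bool" where
  "integrably_quasi_Lipschitzian M \<Phi> xb yb \<longleftrightarrow>
     (\<exists>\<eta>>0. \<exists>l\<in>L1_pos M. \<forall>x y ys.
        x \<in> Linf M \<and> Linf_norm M (\<lambda>t. x t - xb) \<le> ereal \<eta> \<and>
        integrable M y \<and> L1_norm M (\<lambda>t. y t - yb t) \<le> \<eta> \<and>
        (AE t in M. y t \<in> \<Phi> t (x t)) \<and>
        ys \<in> Linf M \<longrightarrow>
        (AE t in M. (SUP xs\<in>coderivative (\<Phi> t) (x t, y t) (ys t). ereal (norm xs))
                      \<le> ereal (l t * norm (ys t))))"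

end

theory Submission
  imports Defs
begin

text \<open>If the Lipschitz property fails on a nonnegligible set of \<open>t\<close>, then for some member
  \<open>(x', y, d)\<close> of a countable family of parameters the function
  \<open>l(t) |u - x'| + sqrt (|v - y|\<^sup>2 + d\<^sup>2)\<close> has, for nonnegligibly many \<open>t\<close>, a minimizer \<open>(u, v)\<close>
  over the graph of \<open>\<Phi>\<^sub>t\<close> with \<open>u \<noteq> x'\<close>. Fermat's rule turns such a minimizer into a regular normal
  \<open>(x\<^sup>*, -y\<^sup>*)\<close> with \<open>|x\<^sup>*| = l(t) > l(t) |y\<^sup>*|\<close>. The minimizers can be selected measurably, and
  nonatomicity allows the selection to be used on so small a set that the modified \<open>y\<close> stays close in
  \<open>L\<^sup>1\<close> to the given one; this contradicts the quasi-Lipschitz estimate. Measurable projection and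
  selection come from Choquet's capacity argument for Souslin sets. On an atom, integrable functions
  cannot be modified on small sets: there the mapping with \<open>\<Phi>\<^sub>t(0) = {0, e}\<close> and \<open>\<Phi>\<^sub>t(x) = {0}\<close> for
  \<open>x \<noteq> 0\<close> violates only the Lipschitz property.\<close>

section \<open>Souslin sets\<close>

text \<open>The quasi-Lipschitz estimate tests only integrable selections, whereas the Lipschitz
  property is pointwise in t, so a pointwise violation must be packaged into admissible functions.
  The L1 tolerance restricts only the integral of the modification; a minimizer may therefore lie
  far away in y, as long as it is used on a sufficiently small set. No localization in y is needed,
  and global minimizers over the graph can be taken. The parameters are countable because each of
  them produces its own null set. The smoothing parameter d > 0 makes the second term of the penalty
  differentiable everywhere with gradient of norm below 1, while away from x' the first term has a
  gradient of norm exactly l(t): this strict gap is the contradiction. Letting d tend to 0 and the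
  centre tend to a given point recovers the exact Lipschitz inequality, by closedness of the graph.
  Minimality over a graph is a condition on uncountably many competitors. Its measurability is a
  statement about projections, where inner regularity of Souslin sets together with completeness of
  the measure enters; the same inner approximation delivers the selection.\<close>

definition souslin_scheme :: "'z set set \<Rightarrow> (nat \<Rightarrow> (nat \<Rightarrow> nat) \<Rightarrow> 'z set) \<Rightarrow> bool" where
  "souslin_scheme \<P> P \<longleftrightarrow>
     (\<forall>k s. P k s \<in> \<P>) \<and> (\<forall>k s s'. (\<forall>i<k. s i = s' i) \<longrightarrow> P k s = P k s')"

text \<open>The Suslin operation. The set attached to the finite sequence s 0, ..., s (k-1) is
  stored as \<open>P k s\<close> with a total \<open>s\<close>, which is why
  \<open>souslin_scheme\<close> asks for dependence on the first k entries only; level 0 is a single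
  set. Monotonicity in k is not imposed.\<close>

definition souslin_kernel :: "(nat \<Rightarrow> (nat \<Rightarrow> nat) \<Rightarrow> 'z set) \<Rightarrow> 'z set" where
  "souslin_kernel P = {z. \<exists>s. \<forall>k. z \<in> P k s}"

definition souslin :: "'z set set \<Rightarrow> 'z set \<Rightarrow> bool" where
  "souslin \<P> S \<longleftrightarrow> (\<exists>P. souslin_scheme \<P> P \<and> S = souslin_kernel P)"

lemma souslin_schemeD:
  assumes "souslin_scheme \<P> P"
  shows "P k s \<in> \<P>" and "\<forall>i<k. s i = s' i \<Longrightarrow> P k s = P k s'"
  using assms by (auto simp: souslin_scheme_def)

lemma souslin_base: "A \<in> \<P> \<Longrightarrow> souslin \<P> A"
  unfolding souslin_def
  by (intro exI[of _ "\<lambda>_ _. A"]) (auto simp: souslin_scheme_def souslin_kernel_def)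

lemma souslin_UN:
  assumes S: "\<And>n::nat. souslin \<P> (S n)" and \<Omega>: "\<Omega> \<in> \<P>" "\<Union>\<P> \<subseteq> \<Omega>"
  shows "souslin \<P> (\<Union>n. S n)"
proof -
  have "\<forall>n. \<exists>P. souslin_scheme \<P> P \<and> S n = souslin_kernel P"
    using S[unfolded souslin_def] by (rule allI)
  from choice[OF this] obtain P where PP: "\<forall>n. souslin_scheme \<P> (P n) \<and> S n = souslin_kernel (P n)" ..
  then have P: "P n k s \<in> \<P>" and dep: "\<forall>i<k. s i = s' i \<Longrightarrow> P n k s = P n k s'" for n k s s'
    using souslin_schemeD by blast+
  have eq: "S n = {z. \<exists>s. \<forall>k. z \<in> P n k s}" for n using PP by (simp add: souslin_kernel_def)
  \<comment> \<open>The entry \<open>s 0\<close> picks the member of the family and the shifted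
    sequence runs its scheme. Level 0 may not look at \<open>s 0\<close> yet, so it gets the whole
    space.\<close>
  define Q where "Q k s = (case k of 0 \<Rightarrow> \<Omega> | Suc j \<Rightarrow> P (s 0) j (\<lambda>i. s (Suc i)))" for k s
  have "(\<Union>n. S n) = {z. \<exists>s. \<forall>k. z \<in> Q k s}"
  proof (intro set_eqI iffI)
    fix z assume "z \<in> (\<Union>n. S n)"
    then obtain n s where *: "\<And>k. z \<in> P n k s" by (auto simp: eq)
    then have "z \<in> \<Omega>" using P \<Omega> by blast
    then have "z \<in> Q k (case_nat n s)" for k
      using * by (auto simp: Q_def split: nat.splits)
    then show "z \<in> {z. \<exists>s. \<forall>k. z \<in> Q k s}" by blast
  next
    fix z assume "z \<in> {z. \<exists>s. \<forall>k. z \<in> Q k s}"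
    then obtain s where s: "\<And>k. z \<in> Q k s" by blast
    have "z \<in> P (s 0) k (\<lambda>i. s (Suc i))" for k using s[of "Suc k"] by (simp add: Q_def)
    then show "z \<in> (\<Union>n. S n)" by (auto simp: eq)
  qed
  moreover have "Q k s \<in> \<P>" for k s using P \<Omega> by (auto simp: Q_def split: nat.splits)
  moreover have "Q k s = Q k s'" if "\<forall>i<k. s i = s' i" for k s s'
    using that by (auto simp: Q_def split: nat.splits intro!: dep)
  ultimately show ?thesis
    unfolding souslin_def souslin_scheme_def souslin_kernel_def by (intro exI[of _ Q]) simp
qed

lemma souslin_INT:
  assumes S: "\<And>n::nat. souslin \<P> (S n)"
  shows "souslin \<P> (\<Inter>n. S n)"
proof -
  have "\<forall>n. \<exists>P. souslin_scheme \<P> P \<and> S n = souslin_kernel P"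
    using S[unfolded souslin_def] by (rule allI)
  from choice[OF this] obtain P where PP: "\<forall>n. souslin_scheme \<P> (P n) \<and> S n = souslin_kernel (P n)" ..
  then have P: "P n k s \<in> \<P>" and dep: "\<forall>i<k. s i = s' i \<Longrightarrow> P n k s = P n k s'" for n k s s'
    using souslin_schemeD by blast+
  have eq: "S n = {z. \<exists>s. \<forall>k. z \<in> P n k s}" for n using PP by (simp add: souslin_kernel_def)
  \<comment> \<open>One sequence codes countably many: its entries at
    \<open>prod_encode (n, i)\<close> form the n-th. Level \<open>j = prod_encode (n, k)\<close>
    tests level k of the n-th scheme.\<close>
  define Q where "Q j s = (case prod_decode j of (n, k) \<Rightarrow> P n k (\<lambda>i. s (prod_encode (n, i))))" for j s
  have "(\<Inter>n. S n) = {z. \<exists>s. \<forall>k. z \<in> Q k s}"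
  proof (intro set_eqI iffI)
    fix z assume "z \<in> (\<Inter>n. S n)"
    then have "\<forall>n. \<exists>s. \<forall>k. z \<in> P n k s" by (auto simp: eq)
    then obtain s where *: "\<And>n k. z \<in> P n k (s n)" by (auto dest!: choice)
    define r where "r j = (case prod_decode j of (n, i) \<Rightarrow> s n i)" for j
    have "z \<in> Q k r" for k
      using * by (auto simp: Q_def r_def split: prod.splits)
    then show "z \<in> {z. \<exists>s. \<forall>k. z \<in> Q k s}" by blast
  next
    fix z assume "z \<in> {z. \<exists>s. \<forall>k. z \<in> Q k s}"
    then obtain s where s: "\<And>k. z \<in> Q k s" by blast
    have "z \<in> P n k (\<lambda>i. s (prod_encode (n, i)))" for n k
      using s[of "prod_encode (n, k)"] by (simp add: Q_def)
    then show "z \<in> (\<Inter>n. S n)" by (auto simp: eq)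
  qed
  moreover have "Q k s \<in> \<P>" for k s using P by (auto simp: Q_def split: prod.splits)
  moreover have "Q j s = Q j s'" if "\<forall>i<j. s i = s' i" for j s s'
  proof -
    obtain n k where nk: "prod_decode j = (n, k)" by force
    then have j: "j = prod_encode (n, k)" by (metis prod_decode_inverse)
    \<comment> \<open>Prefix dependence: the pairing increases in its second argument, so the
      entries read at level j all lie before j.\<close>
    have "prod_encode (n, i) < j" if "i < k" for i
    proof -
      have "strict_mono triangle" by (rule strict_monoI_Suc) simp
      then have "triangle (n + i) < triangle (n + k)" using that by (simp add: strict_mono_less)
      then show ?thesis by (simp add: j prod_encode_def)
    qed
    then show ?thesis using that by (auto simp: Q_def nk intro!: dep)
  qed
  ultimately show ?thesis
    unfolding souslin_def souslin_scheme_def souslin_kernel_def by (intro exI[of _ Q]) simp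
qed

section \<open>Product-measurable sets are Souslin over rectangles\<close>

definition rectangles :: "'t measure \<Rightarrow> ('t \<times> 'a::topological_space) set set" where
  "rectangles M = {A \<times> F | A F. A \<in> sets M \<and> closed F}"

lemma rectangles_Int:
  assumes "C \<in> rectangles M" "D \<in> rectangles M" shows "C \<inter> D \<in> rectangles M"
proof -
  obtain A F B G where "C = A \<times> F" "D = B \<times> G" "A \<in> sets M" "B \<in> sets M" "closed F" "closed G"
    using assms unfolding rectangles_def by blast
  then show ?thesis unfolding rectangles_def
    by (auto intro!: exI[of _ "A \<inter> B"] exI[of _ "F \<inter> G"])
qed

text \<open>Distance levels exhibit an open set as an F-sigma set; this is needed because
  \<open>rectangles\<close> admits only closed sides. The empty set is treated apart since
  \<open>infdist\<close> to it is 0 by convention.\<close>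

lemma closed_complement_UN_closed:
  fixes F :: "'a::metric_space set"
  assumes "closed F"
  obtains G :: "nat \<Rightarrow> 'a set" where "\<And>n. closed (G n)" "- F = (\<Union>n. G n)"
proof (cases "F = {}")
  case True
  then show ?thesis using that[of "\<lambda>_. UNIV"] by auto
next
  case False
  show ?thesis
  proof (rule that[of "\<lambda>n. {x. infdist x F \<ge> inverse (real (Suc n))}"])
    show "closed {x. infdist x F \<ge> inverse (real (Suc n))}" for n
      by (intro closed_Collect_le continuous_intros)
    show "- F = (\<Union>n. {x. infdist x F \<ge> inverse (real (Suc n))})"
    proof (intro set_eqI iffI)
      fix x assume "x \<in> - F"
      then have "infdist x F > 0"
        using False assms infdist_nonneg[of x F] by (auto simp: in_closed_iff_infdist_zero less_le)
      then obtain n where "inverse (real (Suc n)) < infdist x F"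
        using reals_Archimedean by blast
      then show "x \<in> (\<Union>n. {x. infdist x F \<ge> inverse (real (Suc n))})" by (auto intro: less_imp_le)
    next
      fix x assume "x \<in> (\<Union>n. {x. infdist x F \<ge> inverse (real (Suc n))})"
      then obtain n where n: "infdist x F \<ge> inverse (real (Suc n))" by blast
      have "inverse (real (Suc n)) > 0" by simp
      with n have "infdist x F > 0" by linarith
      then show "x \<in> - F" using infdist_zero[of x F] by auto
    qed
  qed
qed

text \<open>Souslin sets are in general not stable under complements, so the sets that are Souslin
  together with their complement are shown to form a sigma-algebra \<open>D\<close>. Both coordinate
  maps are measurable with respect to \<open>D\<close>; hence so is the identity into the product
  space, and its preimages are the measurable sets themselves.\<close>

lemma souslin_pair_measure:
  fixes S :: "('t \<times> 'a::metric_space) set"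
  assumes "S \<in> sets (M \<Otimes>\<^sub>M borel)"
  shows "souslin (rectangles M) S"
proof -
  define \<Omega> :: "('t \<times> 'a) set" where "\<Omega> = space M \<times> UNIV"
  let ?R = "rectangles M :: ('t \<times> 'a) set set"
  have \<Omega>: "\<Omega> \<in> ?R" "\<Union>?R \<subseteq> \<Omega>"
    using sets.sets_into_space by (auto simp: rectangles_def \<Omega>_def)
  define D where "D = {S. S \<subseteq> \<Omega> \<and> souslin ?R S \<and> souslin ?R (\<Omega> - S)}"
  have "sigma_algebra \<Omega> D"
    unfolding sigma_algebra_iff2
  proof (intro conjI ballI allI impI)
    show "D \<subseteq> Pow \<Omega>" by (auto simp: D_def)
    have "{} \<in> ?R" unfolding rectangles_def by blast
    then show "{} \<in> D" using \<Omega> by (auto simp: D_def intro: souslin_base)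
    show "\<Omega> - s \<in> D" if "s \<in> D" for s
      using that by (auto simp: D_def double_diff)
    show "(\<Union>i. A i) \<in> D" if "range A \<subseteq> D" for A :: "nat \<Rightarrow> _"
    proof -
      have A: "A i \<subseteq> \<Omega>" "souslin ?R (A i)" "souslin ?R (\<Omega> - A i)" for i
        using that by (auto simp: D_def)
      have "\<Omega> - (\<Union>i. A i) = (\<Inter>i. \<Omega> - A i)" by auto
      then have "souslin ?R (\<Omega> - (\<Union>i. A i))" using souslin_INT[OF A(3)] by simp
      moreover have "souslin ?R (\<Union>i. A i)" by (rule souslin_UN[OF A(2) \<Omega>])
      ultimately show ?thesis using A(1) by (auto simp: D_def)
    qed
  qed
  then have sN: "sets (sigma \<Omega> D) = D" and spN: "space (sigma \<Omega> D) = \<Omega>"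
    by (simp_all add: sigma_algebra.sets_measure_of_eq sigma_algebra.space_measure_of_eq)
  have fst: "fst \<in> sigma \<Omega> D \<rightarrow>\<^sub>M M"
  proof (rule measurableI)
    fix A assume A: "A \<in> sets M"
    then have "A \<subseteq> space M" by (rule sets.sets_into_space)
    then have e: "fst -` A \<inter> \<Omega> = A \<times> UNIV" "\<Omega> - A \<times> UNIV = (space M - A) \<times> UNIV"
      by (auto simp: \<Omega>_def)
    have "A \<times> UNIV \<in> ?R" "(space M - A) \<times> UNIV \<in> ?R"
      using A unfolding rectangles_def by blast+
    then have "A \<times> UNIV \<in> D"
      using e \<Omega> by (auto simp: D_def intro: souslin_base)
    then show "fst -` A \<inter> space (sigma \<Omega> D) \<in> sets (sigma \<Omega> D)"
      unfolding spN sN e .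
  qed (metis spN \<Omega>_def mem_Sigma_iff prod.collapse)
  have snd: "snd \<in> borel_measurable (sigma \<Omega> D)"
  proof (rule borel_measurableI)
    fix U :: "'a set" assume U: "open U"
    then have F: "closed (- U)" by auto
    obtain G :: "nat \<Rightarrow> 'a set" where G: "\<And>n. closed (G n)" "U = (\<Union>n. G n)"
      using closed_complement_UN_closed[OF F] by (metis double_compl)
    have e: "snd -` U \<inter> \<Omega> = space M \<times> U" "space M \<times> U = (\<Union>n. space M \<times> G n)"
      "\<Omega> - space M \<times> U = space M \<times> (- U)"
      using G(2) by (auto simp: \<Omega>_def)
    have "space M \<times> (- U) \<in> ?R" "space M \<times> G n \<in> ?R" for n
      using F G(1) unfolding rectangles_def by blast+
    then have "souslin ?R (space M \<times> (- U))" "souslin ?R (\<Union>n. space M \<times> G n)"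
      using \<Omega> by (auto intro: souslin_base souslin_UN)
    then have "space M \<times> U \<in> D"
      using e by (auto simp: D_def)
    then show "snd -` U \<inter> space (sigma \<Omega> D) \<in> sets (sigma \<Omega> D)"
      unfolding spN sN e .
  qed
  have "(\<lambda>z. (fst z, snd z)) \<in> sigma \<Omega> D \<rightarrow>\<^sub>M M \<Otimes>\<^sub>M borel"
    using fst snd by (rule measurable_Pair)
  from measurable_sets[OF this assms]
  have "S \<inter> \<Omega> \<in> D" by (simp add: spN sN)
  moreover have "S \<subseteq> \<Omega>" using sets.sets_into_space[OF assms] by (auto simp: space_pair_measure \<Omega>_def)
  ultimately show ?thesis by (auto simp: D_def Int_absorb2)
qed

text \<open>Koenig's lemma. A prefix is good if infinitely many \<open>r j\<close> extend it. Entry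
  k of \<open>r j\<close> is bounded as soon as j > k, so after dropping the finitely many j up to k
  the pigeonhole principle extends a good prefix.\<close>

lemma finitely_branching_limit:
  fixes m :: "nat \<Rightarrow> nat" and r :: "nat \<Rightarrow> nat \<Rightarrow> nat"
  assumes "\<And>j i. i < j \<Longrightarrow> r j i \<le> m i"
  obtains s where "\<And>k. infinite {j. \<forall>i<k. r j i = s i}"
proof -
  define Good where "Good k s \<longleftrightarrow> infinite {j. \<forall>i<k. r j i = s i}" for k and s :: "nat \<Rightarrow> nat"
  have "\<exists>f. \<forall>k. Good k (f k) \<and> (\<forall>i. i \<noteq> k \<longrightarrow> f (Suc k) i = f k i)"
  proof (rule dependent_nat_choice)
    show "\<exists>x. Good 0 x" by (simp add: Good_def)
    fix s k assume g: "Good k s"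
    have sub: "{j. \<forall>i<k. r j i = s i} \<subseteq> {..k} \<union> (\<Union>a\<in>{..m k}. {j. \<forall>i<Suc k. r j i = (s(k := a)) i})"
    proof
      fix j assume j: "j \<in> {j. \<forall>i<k. r j i = s i}"
      show "j \<in> {..k} \<union> (\<Union>a\<in>{..m k}. {j. \<forall>i<Suc k. r j i = (s(k := a)) i})"
      proof (cases "j \<le> k")
        case False
        then have "r j k \<le> m k" using assms by simp
        moreover have "\<forall>i<Suc k. r j i = (s(k := r j k)) i" using j by (auto simp: less_Suc_eq)
        ultimately show ?thesis by blast
      qed simp
    qed
    have "\<not> (\<forall>a\<in>{..m k}. finite {j. \<forall>i<Suc k. r j i = (s(k := a)) i})"
    proof
      assume "\<forall>a\<in>{..m k}. finite {j. \<forall>i<Suc k. r j i = (s(k := a)) i}"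
      then have "finite ({..k} \<union> (\<Union>a\<in>{..m k}. {j. \<forall>i<Suc k. r j i = (s(k := a)) i}))" by blast
      with sub g show False unfolding Good_def using finite_subset by blast
    qed
    then obtain a where "Good (Suc k) (s(k := a))" unfolding Good_def by blast
    then show "\<exists>y. Good (Suc k) y \<and> (\<forall>i. i \<noteq> k \<longrightarrow> y i = s i)" by (intro exI[of _ "s(k := a)"]) auto
  qed
  then obtain f where f: "\<And>k. Good k (f k)" "\<And>k i. i \<noteq> k \<Longrightarrow> f (Suc k) i = f k i" by blast
  have st: "f k i = f (Suc i) i" if "i < k" for k i
    using that
  proof (induction k)
    case (Suc k)
    then show ?case using f(2)[of i k] by (cases "i = k") auto
  qed simp
  have "infinite {j. \<forall>i<k. r j i = f (Suc i) i}" for k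
    using f(1)[of k] st[of _ k] by (simp add: Good_def)
  then show ?thesis by (rule that)
qed

section \<open>Inner approximation, measurable projection and selection\<close>

text \<open>The graph of a compact-valued multifunction for which preimages of closed sets are
  measurable. Measurability of projections is built in, so such sets can be handled before the
  projection theorem is available.\<close>

definition compact_random_set :: "'t measure \<Rightarrow> ('t \<times> 'a::topological_space) set \<Rightarrow> bool" where
  "compact_random_set M C \<longleftrightarrow> (\<forall>t. compact (Pair t -` C)) \<and>
     (\<forall>F. closed F \<longrightarrow> fst ` (C \<inter> UNIV \<times> F) \<in> sets M)"

lemma compact_random_set_fst:
  assumes "compact_random_set M C" shows "fst ` C \<in> sets M"
  using assms unfolding compact_random_set_def by (metis closed_UNIV UNIV_Times_UNIV Int_UNIV_right)

lemma compact_random_set_rectangle: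
  fixes K :: "'a::t2_space set"
  assumes "C \<in> rectangles M" "compact K"
  shows "compact_random_set M (C \<inter> UNIV \<times> K)"
proof -
  obtain A G where C: "C = A \<times> G" "A \<in> sets M" "closed G"
    using assms unfolding rectangles_def by blast
  have "Pair t -` (C \<inter> UNIV \<times> K) = (if t \<in> A then G \<inter> K else {})" for t
    by (auto simp: C)
  moreover have "fst ` ((C \<inter> UNIV \<times> K) \<inter> UNIV \<times> F) = (if G \<inter> K \<inter> F = {} then {} else A)" for F
    by (force simp: C image_iff)
  ultimately show ?thesis
    using C assms by (auto simp: compact_random_set_def intro: closed_Int_compact)
qed

lemma compact_random_set_UN:
  assumes "finite I" "\<And>i. i \<in> I \<Longrightarrow> compact_random_set M (C i)"
  shows "compact_random_set M (\<Union>i\<in>I. C i)"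
proof -
  have "Pair t -` (\<Union>i\<in>I. C i) = (\<Union>i\<in>I. Pair t -` C i)" for t by auto
  moreover have "fst ` ((\<Union>i\<in>I. C i) \<inter> UNIV \<times> F) = (\<Union>i\<in>I. fst ` (C i \<inter> UNIV \<times> F))" for F by auto
  ultimately show ?thesis
    using assms by (auto simp: compact_random_set_def intro!: compact_UN sets.finite_UN)
qed

lemma decreasing_compact_INT:
  fixes K :: "nat \<Rightarrow> 'a::t2_space set"
  assumes "\<And>n. compact (K n)" "decseq K" "\<And>n. K n \<noteq> {}"
  shows "(\<Inter>n. K n) \<noteq> {}"
proof
  assume e: "(\<Inter>n. K n) = {}"
  have "K 0 \<inter> (\<Inter>n. K n) \<noteq> {}"
  proof (rule compact_imp_fip_image)
    show "compact (K 0)" by fact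
    show "closed (K i)" if "i \<in> UNIV" for i by (rule compact_imp_closed[OF assms(1)])
    fix I :: "nat set" assume I: "finite I"
    define N where "N = Max (insert 0 I)"
    have "K N \<subseteq> K i" if "i \<in> insert 0 I" for i
      unfolding N_def by (rule decseqD[OF assms(2)], rule Max_ge) (use that I in auto)
    then have "K N \<subseteq> K 0 \<inter> (\<Inter>i\<in>I. K i)" by blast
    then show "K 0 \<inter> (\<Inter>i\<in>I. K i) \<noteq> {}" using assms(3)[of N] by blast
  qed
  with e show False by blast
qed

text \<open>A point common to all projections lies under a decreasing sequence of nonempty compact
  sections, which share a point. Without compactness, projection need not commute with decreasing
  intersections; this is why balls of finite radius appear in the projection theorem.\<close>

lemma fst_image_decreasing_INT:
  fixes C :: "nat \<Rightarrow> ('t \<times> 'a::t2_space) set"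
  assumes "\<And>n. compact_random_set M (C n)" "decseq C" "closed F"
  shows "fst ` ((\<Inter>n. C n) \<inter> UNIV \<times> F) = (\<Inter>n. fst ` (C n \<inter> UNIV \<times> F))"
proof
  show "(\<Inter>n. fst ` (C n \<inter> UNIV \<times> F)) \<subseteq> fst ` ((\<Inter>n. C n) \<inter> UNIV \<times> F)"
  proof
    fix t assume t: "t \<in> (\<Inter>n. fst ` (C n \<inter> UNIV \<times> F))"
    have "(\<Inter>n. Pair t -` C n \<inter> F) \<noteq> {}"
    proof (rule decreasing_compact_INT)
      show "compact (Pair t -` C n \<inter> F)" for n
        using assms(1)[of n] assms(3) by (auto simp: compact_random_set_def intro: compact_Int_closed)
      show "decseq (\<lambda>n. Pair t -` C n \<inter> F)"
        using assms(2) by (auto simp: decseq_def)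
      show "Pair t -` C n \<inter> F \<noteq> {}" for n
      proof -
        from t have "t \<in> fst ` (C n \<inter> UNIV \<times> F)" by blast
        then show ?thesis by (force simp: image_iff)
      qed
    qed
    then obtain z where "\<And>n. (t, z) \<in> C n" "z \<in> F" by blast
    then have "(t, z) \<in> (\<Inter>n. C n) \<inter> UNIV \<times> F" by simp
    then show "t \<in> fst ` ((\<Inter>n. C n) \<inter> UNIV \<times> F)" by (metis fst_conv imageI)
  qed
  show "fst ` ((\<Inter>n. C n) \<inter> UNIV \<times> F) \<subseteq> (\<Inter>n. fst ` (C n \<inter> UNIV \<times> F))" by blast
qed

lemma compact_random_set_INT:
  fixes C :: "nat \<Rightarrow> ('t \<times> 'a::t2_space) set"
  assumes C: "\<And>n. compact_random_set M (C n)" and "decseq C"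
  shows "compact_random_set M (\<Inter>n. C n)"
proof -
  have "compact (Pair t -` (\<Inter>n. C n))" for t
  proof -
    have "Pair t -` (\<Inter>n. C n) = Pair t -` C 0 \<inter> (\<Inter>n. Pair t -` C n)" by auto
    moreover have "compact (Pair t -` C n)" for n using C by (auto simp: compact_random_set_def)
    ultimately show ?thesis by (auto intro!: compact_Int_closed closed_INT intro: compact_imp_closed)
  qed
  moreover have "fst ` ((\<Inter>n. C n) \<inter> UNIV \<times> F) \<in> sets M" if "closed F" for F
    unfolding fst_image_decreasing_INT[OF assms that]
    using C that by (auto simp: compact_random_set_def)
  ultimately show ?thesis by (auto simp: compact_random_set_def)
qed

text \<open>Choquet's capacitability argument. The entries of the index sequences are bounded one at
  a time, keeping the outer measure of the projection above \<open>c\<close>. Once all bounds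
  \<open>m\<close> are fixed, only finitely many prefixes of each length survive, so the finite
  stages are compact random sets, and by Koenig's lemma their intersection still lies in
  \<open>S\<close>.\<close>

lemma souslin_inner_approximation:
  fixes S :: "('t \<times> 'a::t2_space) set"
  assumes M: "finite_measure M" and S: "souslin (rectangles M) S" and K: "compact K" "S \<subseteq> UNIV \<times> K"
    and c: "c < outer_measure_of M (fst ` S)"
  obtains C where "C \<subseteq> S" "compact_random_set M C" "c \<le> emeasure M (fst ` C)"
proof -
  interpret finite_measure M by fact
  obtain P where "souslin_scheme (rectangles M) P" and "S = souslin_kernel P"
    using S unfolding souslin_def by blast
  then have P: "P k s \<in> rectangles M" and dep: "\<forall>i<k. s i = s' i \<Longrightarrow> P k s = P k s'"
    and SP: "S = {z. \<exists>s. \<forall>k. z \<in> P k s}" for k s s'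
    using souslin_schemeD unfolding souslin_kernel_def by blast+
  have Psp: "P k s \<subseteq> space M \<times> UNIV" for k s
    using P[of k s] sets.sets_into_space by (fastforce simp: rectangles_def)
  define R where "R j m = {z. \<exists>s. (\<forall>i<j. s i \<le> m i) \<and> (\<forall>k. z \<in> P k s)}" for j and m :: "nat \<Rightarrow> nat"
  have Rsp: "fst ` R j m \<subseteq> space M" for j m using Psp by (fastforce simp: R_def)
  \<comment> \<open>Step j fixes entry j of the bound and later steps do not change it, so the
    successive bounds have a common limit.\<close>
  have "\<exists>m. \<forall>j. c < outer_measure_of M (fst ` R j (m j)) \<and> (\<forall>i. i \<noteq> j \<longrightarrow> m (Suc j) i = m j i)"
  proof (rule dependent_nat_choice)
    have "R 0 (\<lambda>_. 0) = S" by (auto simp: R_def SP)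
    then show "\<exists>m. c < outer_measure_of M (fst ` R 0 m)" using c by metis
    fix m j assume m: "c < outer_measure_of M (fst ` R j m)"
    let ?A = "\<lambda>a. fst ` R (Suc j) (m(j := a))"
    have "R j m = (\<Union>a. R (Suc j) (m(j := a)))"
    proof (intro set_eqI iffI)
      fix z assume "z \<in> R j m"
      then obtain s where "\<forall>i<j. s i \<le> m i" "\<forall>k. z \<in> P k s" by (auto simp: R_def)
      then have "z \<in> R (Suc j) (m(j := s j))" by (auto simp: R_def less_Suc_eq intro!: exI[of _ s])
      then show "z \<in> (\<Union>a. R (Suc j) (m(j := a)))" by blast
    next
      fix z assume "z \<in> (\<Union>a. R (Suc j) (m(j := a)))"
      then obtain a s where s: "\<forall>i<Suc j. s i \<le> (m(j := a)) i" "\<forall>k. z \<in> P k s" by (auto simp: R_def)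
      have "s i \<le> m i" if "i < j" for i using s(1)[rule_format, of i] that by auto
      with s(2) show "z \<in> R j m" unfolding R_def by blast
    qed
    then have "fst ` R j m = (\<Union>a. ?A a)" by auto
    moreover have "incseq ?A"
    proof (rule incseq_SucI, rule image_mono, rule subsetI)
      fix a z assume "z \<in> R (Suc j) (m(j := a))"
      then obtain s where s: "\<forall>i<Suc j. s i \<le> (m(j := a)) i" "\<forall>k. z \<in> P k s" by (auto simp: R_def)
      have "s i \<le> (m(j := Suc a)) i" if "i < Suc j" for i
        using s(1)[rule_format, of i] that by (auto split: if_splits)
      with s(2) show "z \<in> R (Suc j) (m(j := Suc a))" unfolding R_def by blast
    qed
    \<comment> \<open>Measurability of these projections is not known at this point; outer measure
      is nonetheless continuous along increasing sequences of arbitrary subsets of the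
      space.\<close>
    ultimately have "(SUP a. outer_measure_of M (?A a)) = outer_measure_of M (fst ` R j m)"
      using Rsp by (subst SUP_outer_measure_of_incseq) auto
    with m have "c < (SUP a. outer_measure_of M (?A a))" by simp
    then obtain a where "c < outer_measure_of M (?A a)" unfolding less_SUP_iff by blast
    then show "\<exists>y. c < outer_measure_of M (fst ` R (Suc j) y) \<and> (\<forall>i. i \<noteq> j \<longrightarrow> y i = m i)"
      by (intro exI[of _ "m(j := a)"]) auto
  qed
  then obtain \<mu> where \<mu>: "\<And>j. c < outer_measure_of M (fst ` R j (\<mu> j))"
    "\<And>j i. i \<noteq> j \<Longrightarrow> \<mu> (Suc j) i = \<mu> j i" by blast
  have st: "\<mu> k i = \<mu> (Suc i) i" if "i < k" for k i
    using that
  proof (induction k)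
    case (Suc k)
    then show ?case using \<mu>(2)[of i k] by (cases "i = k") auto
  qed simp
  define m where "m i = \<mu> (Suc i) i" for i
  have R: "c < outer_measure_of M (fst ` R j m)" for j
    using \<mu>(1)[of j] st[of _ j] by (simp add: R_def m_def)
  \<comment> \<open>Unlike in \<open>R j m\<close>, only levels up to j are tested, so the witness
    \<open>s\<close> may change with j and \<open>C j\<close> may exceed \<open>S\<close>; in
    exchange, only finitely many prefixes matter.\<close>
  define C where "C j = {z. snd z \<in> K \<and> (\<exists>s. (\<forall>i<j. s i \<le> m i) \<and> (\<forall>k\<le>j. z \<in> P k s))}" for j
  have dec: "decseq C"
  proof (rule decseq_SucI, rule subsetI)
    fix j z assume "z \<in> C (Suc j)"
    then obtain s where "snd z \<in> K" "\<forall>i<Suc j. s i \<le> m i" "\<forall>k\<le>Suc j. z \<in> P k s"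
      unfolding C_def by blast
    then have "snd z \<in> K \<and> (\<forall>i<j. s i \<le> m i) \<and> (\<forall>k\<le>j. z \<in> P k s)" by simp
    then show "z \<in> C j" unfolding C_def by blast
  qed
  have cr: "compact_random_set M (C j)" for j
  proof -
    \<comment> \<open>Representatives of the admissible prefixes of length j, padded by 0 to make
      the index set finite.\<close>
    define I where "I = {s :: nat \<Rightarrow> nat. (\<forall>i<j. s i \<le> m i) \<and> (\<forall>i\<ge>j. s i = 0)}"
    have "I \<subseteq> {s. \<forall>i. (i \<in> {..<j} \<longrightarrow> s i \<in> {..Max (m ` {..<j})}) \<and> (i \<notin> {..<j} \<longrightarrow> s i = 0)}"
      by (auto simp: I_def intro: order_trans[OF _ Max_ge])
    then have "finite I"
      by (rule finite_subset) (rule finite_set_of_finite_funs, auto)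
    have "C j = (\<Union>s\<in>I. (\<Inter>k\<le>j. P k s) \<inter> UNIV \<times> K)"
    proof (intro set_eqI iffI)
      fix z assume "z \<in> C j"
      then obtain s where s: "snd z \<in> K" "\<forall>i<j. s i \<le> m i" "\<forall>k\<le>j. z \<in> P k s" by (auto simp: C_def)
      define s' where "s' i = (if i < j then s i else 0)" for i
      have "P k s' = P k s" if "k \<le> j" for k using that by (intro dep) (auto simp: s'_def)
      moreover have "s' \<in> I" using s by (auto simp: I_def s'_def)
      ultimately show "z \<in> (\<Union>s\<in>I. (\<Inter>k\<le>j. P k s) \<inter> UNIV \<times> K)"
        using s by (cases z) (auto intro!: bexI[of _ s'])
    qed (auto simp: C_def I_def)
    moreover have "(\<Inter>k\<le>j. P k s) \<in> rectangles M" for s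
    proof (induction j)
      case (Suc j)
      then show ?case using P by (auto simp: atMost_Suc intro: rectangles_Int)
    qed (use P in simp)
    ultimately show ?thesis
      using \<open>finite I\<close> K(1) by (simp only: compact_random_set_UN compact_random_set_rectangle)
  qed
  have fC: "fst ` C j \<in> sets M" for j
    by (rule compact_random_set_fst[OF cr])
  show ?thesis
  proof (rule that[of "\<Inter>j. C j"])
    show "compact_random_set M (\<Inter>j. C j)" by (rule compact_random_set_INT[OF cr dec])
    show "(\<Inter>j. C j) \<subseteq> S"
    proof
      fix z assume z: "z \<in> (\<Inter>j. C j)"
      then have "\<forall>j. \<exists>s. (\<forall>i<j. s i \<le> m i) \<and> (\<forall>k\<le>j. z \<in> P k s)" by (auto simp: C_def)
      then obtain r where r: "\<And>j i. i < j \<Longrightarrow> r j i \<le> m i" "\<And>j k. k \<le> j \<Longrightarrow> z \<in> P k (r j)" by metis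
      obtain s where s: "\<And>k. infinite {j. \<forall>i<k. r j i = s i}"
        using finitely_branching_limit[of r m] r(1) by metis
      have "z \<in> P k s" for k
      proof -
        \<comment> \<open>Infinitely many \<open>r j\<close> share the first k entries of
          \<open>s\<close>, so one of them has j large enough to have tested level k.\<close>
        obtain j where "j \<ge> k" "\<forall>i<k. r j i = s i" using s[of k] by (auto simp: infinite_nat_iff_unbounded_le)
        then show ?thesis using r(2)[of k j] dep[of k "r j" s] by auto
      qed
      then show "z \<in> S" by (auto simp: SP)
    qed
    have "fst ` (\<Inter>j. C j) = (\<Inter>j. fst ` C j)"
      using fst_image_decreasing_INT[OF cr dec, of UNIV] by simp
    \<comment> \<open>Continuity from above; finiteness of the measure enters here.\<close>
    moreover have "(INF j. emeasure M (fst ` C j)) = emeasure M (\<Inter>j. fst ` C j)"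
    proof (rule INF_emeasure_decseq)
      show "decseq (\<lambda>j. fst ` C j)" using dec by (auto simp: decseq_def intro!: image_mono)
    qed (use fC in auto)
    moreover have "c \<le> emeasure M (fst ` C j)" for j
    proof -
      have "R j m \<subseteq> C j"
      proof
        fix z assume "z \<in> R j m"
        then obtain s where s: "\<forall>i<j. s i \<le> m i" "\<forall>k. z \<in> P k s" unfolding R_def by blast
        then have "z \<in> S" unfolding SP by blast
        then have "snd z \<in> K" using K(2) by auto
        with s show "z \<in> C j" unfolding C_def by blast
      qed
      then have "outer_measure_of M (fst ` R j m) \<le> outer_measure_of M (fst ` C j)"
        by (intro outer_measure_of_mono image_mono)
      with R[of j] fC show ?thesis by simp
    qed
    ultimately show "c \<le> emeasure M (fst ` (\<Inter>j. C j))"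
      using INF_greatest[of UNIV c "\<lambda>j. emeasure M (fst ` C j)"] by simp
  qed
qed

section \<open>Measurable selections of compact random sets\<close>

lemma in_fst_image_cylinder_iff: "t \<in> fst ` (D \<inter> UNIV \<times> F) \<longleftrightarrow> (\<exists>z. (t, z) \<in> D \<and> z \<in> F)"
  by force

text \<open>A section has a minimizer in \<open>F\<close> exactly when it meets \<open>F\<close> and
  every sublevel set that it meets is also met within \<open>F\<close>. Rational levels suffice,
  which leaves countably many measurable conditions.\<close>

lemma compact_random_set_argmin:
  fixes C :: "('t \<times> 'a::t2_space) set" and \<phi> :: "'a \<Rightarrow> real"
  assumes C: "compact_random_set M C" and \<phi>: "continuous_on UNIV \<phi>"
  defines "C' \<equiv> {(t, z). (t, z) \<in> C \<and> (\<forall>w. (t, w) \<in> C \<longrightarrow> \<phi> z \<le> \<phi> w)}"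
  shows "compact_random_set M C'" and "fst ` C' = fst ` C"
proof -
  have cpt: "compact (Pair t -` C)" for t using C by (simp add: compact_random_set_def)
  have min: "\<exists>z. (t, z) \<in> C \<and> z \<in> F \<and> (\<forall>w. (t, w) \<in> C \<and> w \<in> F \<longrightarrow> \<phi> z \<le> \<phi> w)"
    if "t \<in> fst ` (C \<inter> UNIV \<times> F)" "closed F" for t F
  proof -
    have "compact (Pair t -` C \<inter> F)" using cpt that(2) by (rule compact_Int_closed)
    moreover have "Pair t -` C \<inter> F \<noteq> {}" using that(1) by force
    moreover have "continuous_on (Pair t -` C \<inter> F) \<phi>" using \<phi> by (rule continuous_on_subset) simp
    ultimately obtain z where "z \<in> Pair t -` C \<inter> F" "\<forall>w\<in>Pair t -` C \<inter> F. \<phi> z \<le> \<phi> w"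
      using continuous_attains_inf[of "Pair t -` C \<inter> F" \<phi>] by blast
    then show ?thesis by (intro exI[of _ z]) auto
  qed
  have le: "closed {z. \<phi> z \<le> a}" for a
    by (intro closed_Collect_le continuous_intros \<phi>)
  have proj: "fst ` (C' \<inter> UNIV \<times> F) =
      fst ` (C \<inter> UNIV \<times> F) \<inter> (\<Inter>a\<in>\<rat>. (space M - fst ` (C \<inter> UNIV \<times> {z. \<phi> z \<le> a}))
        \<union> fst ` (C \<inter> UNIV \<times> (F \<inter> {z. \<phi> z \<le> a})))" (is "_ = ?R") if F: "closed F" for F
  proof (intro set_eqI iffI)
    fix t assume "t \<in> fst ` (C' \<inter> UNIV \<times> F)"
    then obtain z where z: "(t, z) \<in> C" "z \<in> F" "\<And>w. (t, w) \<in> C \<Longrightarrow> \<phi> z \<le> \<phi> w"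
      by (auto simp: C'_def)
    have "t \<in> fst ` C" using z(1) by force
    then have tM: "t \<in> space M" using compact_random_set_fst[OF C] sets.sets_into_space by blast
    have "t \<in> fst ` (C \<inter> UNIV \<times> (F \<inter> {z. \<phi> z \<le> a}))" if "t \<in> fst ` (C \<inter> UNIV \<times> {z. \<phi> z \<le> a})" for a
    proof -
      obtain w where "(t, w) \<in> C" "\<phi> w \<le> a" using \<open>t \<in> fst ` (C \<inter> UNIV \<times> {z. \<phi> z \<le> a})\<close> by auto
      then have "(t, z) \<in> C \<inter> UNIV \<times> (F \<inter> {z. \<phi> z \<le> a})" using z(1,2) z(3)[of w] by auto
      then show ?thesis by (metis fst_conv imageI)
    qed
    moreover have "t \<in> fst ` (C \<inter> UNIV \<times> F)" using z(1,2) by force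
    ultimately show "t \<in> ?R" using tM by blast
  next
    fix t assume t: "t \<in> ?R"
    then have "t \<in> fst ` (C \<inter> UNIV \<times> F)" by blast
    from min[OF this F] obtain z where z: "(t, z) \<in> C" "z \<in> F"
      "\<And>w. (t, w) \<in> C \<Longrightarrow> w \<in> F \<Longrightarrow> \<phi> z \<le> \<phi> w" by blast
    have "\<phi> z \<le> \<phi> w" if w: "(t, w) \<in> C" for w
    proof (rule ccontr)
      assume "\<not> \<phi> z \<le> \<phi> w"
      then obtain a where a: "a \<in> \<rat>" "\<phi> w < a" "a < \<phi> z" using Rats_dense_in_real[of "\<phi> w" "\<phi> z"] by auto
      have "(t, w) \<in> C \<inter> UNIV \<times> {z. \<phi> z \<le> a}" using w a by auto
      then have "t \<in> fst ` (C \<inter> UNIV \<times> {z. \<phi> z \<le> a})" by (metis fst_conv imageI)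
      then have "t \<in> fst ` (C \<inter> UNIV \<times> (F \<inter> {z. \<phi> z \<le> a}))" using t a(1) by blast
      then obtain v where "(t, v) \<in> C" "v \<in> F" "\<phi> v \<le> a" by auto
      with z(3)[of v] a show False by linarith
    qed
    then have "(t, z) \<in> C' \<inter> UNIV \<times> F" using z by (auto simp: C'_def)
    then show "t \<in> fst ` (C' \<inter> UNIV \<times> F)" by (metis fst_conv imageI)
  qed
  have "compact (Pair t -` C')" for t
  proof -
    have "Pair t -` C' = Pair t -` C \<inter> (\<Inter>w\<in>Pair t -` C. {z. \<phi> z \<le> \<phi> w})" by (auto simp: C'_def)
    moreover have "closed (\<Inter>w\<in>Pair t -` C. {z. \<phi> z \<le> \<phi> w})" using le by blast
    ultimately show ?thesis using cpt by (simp add: compact_Int_closed)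
  qed
  moreover have "fst ` (C' \<inter> UNIV \<times> F) \<in> sets M" if F: "closed F" for F
  proof -
    have "fst ` (C \<inter> UNIV \<times> G) \<in> sets M" if "closed G" for G
      using C that by (simp add: compact_random_set_def)
    note G = this
    have "(space M - fst ` (C \<inter> UNIV \<times> {z. \<phi> z \<le> a})) \<union> fst ` (C \<inter> UNIV \<times> (F \<inter> {z. \<phi> z \<le> a})) \<in> sets M" for a
      by (intro sets.Un sets.Diff sets.top G le closed_Int F)
    then show ?thesis unfolding proj[OF F]
      by (intro sets.Int sets.countable_INT' G F countable_rat) auto
  qed
  ultimately show "compact_random_set M C'" by (simp add: compact_random_set_def)
  show "fst ` C' = fst ` C"
  proof
    show "fst ` C' \<subseteq> fst ` C" by (auto simp: C'_def)
    show "fst ` C \<subseteq> fst ` C'"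
    proof
      fix t assume "t \<in> fst ` C"
      then have "t \<in> fst ` (C \<inter> UNIV \<times> UNIV)" by simp
      from min[OF this closed_UNIV] obtain z where "(t, z) \<in> C'" by (auto simp: C'_def)
      then show "t \<in> fst ` C'" by (metis fst_conv imageI)
    qed
  qed
qed

text \<open>A lexicographic minimization along the basis shrinks every section to one point.\<close>

lemma compact_random_set_selection:
  fixes C :: "('t \<times> 'a::euclidean_space) set"
  assumes C: "compact_random_set M C"
  obtains f where "f \<in> borel_measurable M" "\<And>t. t \<in> fst ` C \<Longrightarrow> (t, f t) \<in> C"
proof -
  have "\<exists>D\<subseteq>C. compact_random_set M D \<and> fst ` D = fst ` C \<and>
      (\<forall>t z w. (t, z) \<in> D \<and> (t, w) \<in> D \<longrightarrow> (\<forall>b\<in>B. z \<bullet> b = w \<bullet> b))"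
    if "finite B" for B :: "'a set"
    using that
  proof induction
    case empty
    then show ?case using C by blast
  next
    case (insert b B)
    from insert.IH obtain D where D: "D \<subseteq> C" "compact_random_set M D" "fst ` D = fst ` C"
      and eq: "\<forall>t z w. (t, z) \<in> D \<and> (t, w) \<in> D \<longrightarrow> (\<forall>b\<in>B. z \<bullet> b = w \<bullet> b)"
      by (elim exE conjE)
    let ?D = "{(t, z). (t, z) \<in> D \<and> (\<forall>w. (t, w) \<in> D \<longrightarrow> z \<bullet> b \<le> w \<bullet> b)}"
    have crs: "compact_random_set M ?D" and im: "fst ` ?D = fst ` D"
      by (rule compact_random_set_argmin[OF D(2)], intro continuous_intros)+
    show ?case
    proof (intro exI conjI allI impI)
      show "?D \<subseteq> C" using D(1) by auto
      show "compact_random_set M ?D" by (rule crs)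
      show "fst ` ?D = fst ` C" using im D(3) by (rule trans)
      fix t z w assume "(t, z) \<in> ?D \<and> (t, w) \<in> ?D"
      then have D': "(t, z) \<in> D \<and> (t, w) \<in> D" and "z \<bullet> b \<le> w \<bullet> b" "w \<bullet> b \<le> z \<bullet> b" by simp_all
      then have "z \<bullet> b = w \<bullet> b" by simp
      then show "\<forall>c\<in>insert b B. z \<bullet> c = w \<bullet> c" using eq[rule_format, OF D'] by blast
    qed
  qed
  from this[OF finite_Basis] obtain D where D: "D \<subseteq> C" "compact_random_set M D" "fst ` D = fst ` C"
    and eq: "\<forall>t z w. (t, z) \<in> D \<and> (t, w) \<in> D \<longrightarrow> (\<forall>b\<in>Basis. z \<bullet> b = w \<bullet> b)"
    by (elim exE conjE)
  have uniq: "z = w" if "(t, z) \<in> D" "(t, w) \<in> D" for t z w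
    by (rule euclidean_eqI, rule eq[rule_format]) (use that in auto)
  define f where "f t = (if t \<in> fst ` D then (THE z. (t, z) \<in> D) else 0)" for t
  have f: "f t = z" if "(t, z) \<in> D" for t z
  proof -
    have "t \<in> fst ` D" using that by force
    then show ?thesis unfolding f_def using that uniq by (auto intro!: the_equality)
  qed
  have DF: "fst ` (D \<inter> UNIV \<times> F) \<in> sets M" if "closed F" for F
    using D(2) that by (simp add: compact_random_set_def)
  have Dsp: "fst ` D \<subseteq> space M" using compact_random_set_fst[OF D(2)] by (rule sets.sets_into_space)
  have "f \<in> borel_measurable M"
  proof (rule borel_measurableI)
    fix U :: "'a set" assume U: "open U"
    \<comment> \<open>Off the projection \<open>f\<close> has the default value 0, hence the case
      distinction on \<open>0 \<in> U\<close>. On it the closed complement of \<open>U\<close> is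
      used, since measurability is given for closed sets.\<close>
    have "f -` U \<inter> space M = space M - (fst ` (D \<inter> UNIV \<times> (- U)) \<union> (if 0 \<in> U then {} else space M - fst ` D))"
    proof (intro set_eqI)
      fix t
      show "t \<in> f -` U \<inter> space M \<longleftrightarrow>
        t \<in> space M - (fst ` (D \<inter> UNIV \<times> (- U)) \<union> (if 0 \<in> U then {} else space M - fst ` D))"
      proof (cases "t \<in> fst ` D")
        case True
        then obtain z where z: "(t, z) \<in> D" by force
        have "t \<in> fst ` (D \<inter> UNIV \<times> (- U)) \<longleftrightarrow> z \<notin> U"
          unfolding in_fst_image_cylinder_iff using z uniq[OF z] by blast
        then show ?thesis using True Dsp f[OF z] by auto
      next
        case False
        then have "t \<notin> fst ` (D \<inter> UNIV \<times> (- U))" by blast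
        with False show ?thesis by (auto simp: f_def)
      qed
    qed
    also have "\<dots> \<in> sets M"
      using DF[of "- U"] U compact_random_set_fst[OF D(2)] by auto
    finally show "f -` U \<inter> space M \<in> sets M" .
  qed
  moreover have "(t, f t) \<in> C" if "t \<in> fst ` C" for t
  proof -
    from that D(3) obtain z where "(t, z) \<in> D" by force
    then show ?thesis using f D(1) by auto
  qed
  ultimately show ?thesis by (rule that)
qed

text \<open>A countable union of inner approximations exhausts the outer measure of
  \<open>E\<close>, so it differs from a measurable hull \<open>B\<close> by a null set, with
  \<open>E\<close> squeezed between the two. Completeness makes the remainder measurable.\<close>

lemma inner_regular_imp_measurable:
  assumes M: "finite_measure M" "complete_measure M" and E: "E \<subseteq> space M"
    and inner: "\<And>c. c < outer_measure_of M E \<Longrightarrow> \<exists>A\<in>sets M. A \<subseteq> E \<and> c \<le> emeasure M A"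
  shows "E \<in> sets M"
proof -
  interpret finite_measure M by fact
  interpret complete_measure M by fact
  obtain B where B: "B \<in> sets M" "E \<subseteq> B" "outer_measure_of M E = emeasure M B"
    using outer_measure_of_attain[OF E] by blast
  define I where "I = {A\<in>sets M. A \<subseteq> E}"
  have "emeasure M B \<le> (SUP A\<in>I. emeasure M A)"
  proof (rule dense_le)
    fix c assume "c < emeasure M B"
    then obtain A where "A \<in> I" "c \<le> emeasure M A" using inner[of c] B(3) by (auto simp: I_def)
    then show "c \<le> (SUP A\<in>I. emeasure M A)" by (rule SUP_upper2)
  qed
  moreover have "I \<noteq> {}" by (auto simp: I_def)
  ultimately obtain f :: "nat \<Rightarrow> ennreal" where f: "range f \<subseteq> emeasure M ` I" "(SUP A\<in>I. emeasure M A) = (SUP i. f i)"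
    using ennreal_SUP_countable_SUP[of I "emeasure M"] by blast
  then have "\<forall>i. \<exists>A\<in>I. f i = emeasure M A" by (auto simp: image_iff)
  then obtain A where A: "\<And>i. A i \<in> I" "\<And>i. f i = emeasure M (A i)" by metis
  let ?A = "\<Union>i. A i"
  have UA: "?A \<in> sets M" "?A \<subseteq> E" using A(1) by (auto simp: I_def)
  have "(SUP i. f i) \<le> emeasure M ?A"
    using UA A(1) unfolding A(2) by (intro SUP_least emeasure_mono) auto
  then have "emeasure M B \<le> emeasure M ?A"
    using f(2) \<open>emeasure M B \<le> (SUP A\<in>I. emeasure M A)\<close> by simp
  moreover have "emeasure M ?A \<le> emeasure M B" using UA B by (intro emeasure_mono) auto
  ultimately have "emeasure M B = emeasure M ?A" by (rule antisym)
  moreover have "emeasure M (B - ?A) = emeasure M B - emeasure M ?A"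
    using UA B by (intro emeasure_Diff) auto
  ultimately have "emeasure M (B - ?A) = 0" by simp
  then have "B - ?A \<in> null_sets M" using UA B by auto
  then have "E - ?A \<in> sets M" using B(2) complete[of "E - ?A" "B - ?A"] by auto
  then have "?A \<union> (E - ?A) \<in> sets M" using UA by blast
  then show ?thesis using UA(2) by (simp add: Un_absorb1)
qed

section \<open>Projection and selection for product-measurable sets\<close>

lemma fst_image_UN_cball:
  fixes S :: "('t \<times> 'a::real_normed_vector) set"
  shows "fst ` S = (\<Union>n. fst ` (S \<inter> UNIV \<times> cball 0 (real n)))"
proof
  show "fst ` S \<subseteq> (\<Union>n. fst ` (S \<inter> UNIV \<times> cball 0 (real n)))"
  proof
    fix t assume "t \<in> fst ` S"
    then obtain z where z: "(t, z) \<in> S" by force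
    obtain n where "norm z \<le> real n" using real_arch_simple by blast
    then have "(t, z) \<in> S \<inter> UNIV \<times> cball 0 (real n)" using z by simp
    then have "t \<in> fst ` (S \<inter> UNIV \<times> cball 0 (real n))" by (metis fst_conv imageI)
    then show "t \<in> (\<Union>n. fst ` (S \<inter> UNIV \<times> cball 0 (real n)))" by blast
  qed
qed blast

lemma sets_pair_borel_Int_cylinder:
  assumes "S \<in> sets (M \<Otimes>\<^sub>M borel)" "closed K"
  shows "S \<inter> UNIV \<times> K \<in> sets (M \<Otimes>\<^sub>M borel)"
proof -
  have "S \<inter> UNIV \<times> K = S \<inter> space M \<times> K"
    using sets.sets_into_space[OF assms(1)] by (auto simp: space_pair_measure)
  then show ?thesis using assms by auto
qed

text \<open>Cutting \<open>S\<close> by closed balls provides the compact sets on which inner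
  approximation relies; the whole projection is the countable union of the pieces.\<close>

theorem measurable_projection:
  fixes S :: "('t \<times> 'a::euclidean_space) set"
  assumes M: "finite_measure M" "complete_measure M" and S: "S \<in> sets (M \<Otimes>\<^sub>M borel)"
  shows "fst ` S \<in> sets M"
proof -
  have "fst ` (S \<inter> UNIV \<times> cball 0 (real n)) \<in> sets M" for n
  proof (rule inner_regular_imp_measurable[OF M])
    let ?S = "S \<inter> UNIV \<times> cball 0 (real n)"
    show "fst ` ?S \<subseteq> space M"
      using sets.sets_into_space[OF S] by (auto simp: space_pair_measure)
    fix c assume c: "c < outer_measure_of M (fst ` ?S)"
    have "souslin (rectangles M) ?S"
      using sets_pair_borel_Int_cylinder[OF S] by (intro souslin_pair_measure) auto
    from souslin_inner_approximation[OF M(1) this compact_cball _ c]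
    obtain C where "C \<subseteq> ?S" "compact_random_set M C" "c \<le> emeasure M (fst ` C)" by blast
    then show "\<exists>A\<in>sets M. A \<subseteq> fst ` ?S \<and> c \<le> emeasure M A"
      using compact_random_set_fst by (intro bexI[of _ "fst ` C"]) auto
  qed
  then show ?thesis unfolding fst_image_UN_cball[of S] by blast
qed

text \<open>A selection on some set of positive measure is all that the later proof by contradiction
  uses. Some ball already catches positive measure, inner approximation at a level
  \<open>c > 0\<close> gives a compact random set inside \<open>S\<close>, and compact random sets
  have selections.\<close>

theorem measurable_selection:
  fixes S :: "('t \<times> 'a::euclidean_space) set"
  assumes M: "finite_measure M" "complete_measure M" and S: "S \<in> sets (M \<Otimes>\<^sub>M borel)"
    and pos: "emeasure M (fst ` S) > 0"
  obtains A f where "A \<in> sets M" "emeasure M A > 0" "f \<in> borel_measurable M"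
    "\<And>t. t \<in> A \<Longrightarrow> (t, f t) \<in> S"
proof -
  let ?S = "\<lambda>n. S \<inter> UNIV \<times> cball 0 (real n)"
  have SK: "?S n \<in> sets (M \<Otimes>\<^sub>M borel)" for n by (rule sets_pair_borel_Int_cylinder[OF S]) simp
  have fS: "fst ` ?S n \<in> sets M" for n by (rule measurable_projection[OF M SK])
  obtain n where n: "emeasure M (fst ` ?S n) > 0"
  proof (rule ccontr)
    assume "\<not> thesis"
    then have "emeasure M (fst ` ?S n) = 0" for n using that by (auto simp: zero_less_iff_neq_zero)
    then have "emeasure M (\<Union>n. fst ` ?S n) = 0" using fS by (intro emeasure_UN_eq_0) auto
    with pos show False unfolding fst_image_UN_cball[of S] by simp
  qed
  then obtain c where c: "0 < c" "c < emeasure M (fst ` ?S n)" using dense by blast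
  then have "c < outer_measure_of M (fst ` ?S n)" using fS by simp
  from souslin_inner_approximation[OF M(1) souslin_pair_measure[OF SK] compact_cball _ this]
  obtain C where C: "C \<subseteq> ?S n" "compact_random_set M C" "c \<le> emeasure M (fst ` C)" by blast
  obtain f where f: "f \<in> borel_measurable M" "\<And>t. t \<in> fst ` C \<Longrightarrow> (t, f t) \<in> C"
    using compact_random_set_selection[OF C(2)] by blast
  show ?thesis
  proof (rule that[OF compact_random_set_fst[OF C(2)] _ f(1)])
    show "emeasure M (fst ` C) > 0" using c C(3) by order
    show "(t, f t) \<in> S" if "t \<in> fst ` C" for t using f(2)[OF that] C(1) by blast
  qed
qed

section \<open>Normal cones of graphs and penalty functions\<close>

lemma regular_normal_cone_iff:
  "zs \<in> regular_normal_cone z W \<longleftrightarrow>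
     z \<in> W \<and> (\<forall>e>0. \<forall>\<^sub>F w in at z within W. zs \<bullet> (w - z) \<le> e * norm (w - z))"
proof -
  let ?q = "\<lambda>w. zs \<bullet> (w - z) / norm (w - z)"
  have ne: "\<forall>\<^sub>F w in at z within W. w \<noteq> z" by (simp add: eventually_at_filter)
  have "Limsup (at z within W) (\<lambda>w. ereal (?q w)) \<le> 0 \<longleftrightarrow>
      (\<forall>e>0. \<forall>\<^sub>F w in at z within W. zs \<bullet> (w - z) \<le> e * norm (w - z))" (is "?L \<longleftrightarrow> ?R")
  proof
    assume ?L
    show ?R
    proof (intro allI impI)
      fix e :: real assume "e > 0"
      then have "\<forall>\<^sub>F w in at z within W. ereal (?q w) < ereal e"
        using \<open>?L\<close> by (intro Limsup_lessD) (auto intro: le_less_trans)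
      then show "\<forall>\<^sub>F w in at z within W. zs \<bullet> (w - z) \<le> e * norm (w - z)"
        using ne by eventually_elim (simp add: field_simps)
    qed
  next
    assume R: ?R
    show ?L
      unfolding Limsup_le_iff
    proof (intro allI impI)
      fix c :: ereal assume "c > 0"
      then obtain e where e: "0 < ereal e" "ereal e < c" using ereal_dense2 by blast
      then have "\<forall>\<^sub>F w in at z within W. zs \<bullet> (w - z) \<le> e * norm (w - z)" using R by simp
      with ne show "\<forall>\<^sub>F w in at z within W. ereal (?q w) < c"
      proof eventually_elim
        case (elim w)
        then have "?q w \<le> e" by (simp add: field_simps)
        then have "ereal (?q w) \<le> ereal e" by simp
        then show ?case using e(2) by (rule le_less_trans)
      qed
    qed
  qed
  then show ?thesis by (simp add: regular_normal_cone_def)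
qed

text \<open>Fermat's rule: increments of \<open>f\<close> from \<open>z\<close> within
  \<open>W\<close> are nonnegative, so the linear part \<open>(w - z) \<bullet> g\<close> is bounded
  below by minus the remainder, which is at most \<open>e * norm (w - z)\<close> near
  \<open>z\<close>.\<close>

lemma regular_normal_of_minimizer:
  fixes f :: "'a::real_inner \<Rightarrow> real"
  assumes z: "z \<in> W" and min: "\<And>w. w \<in> W \<Longrightarrow> f z \<le> f w"
    and f: "(f has_derivative (\<lambda>h. h \<bullet> g)) (at z)"
  shows "- g \<in> regular_normal_cone z W"
  unfolding regular_normal_cone_iff
proof (intro conjI z allI impI)
  fix e :: real assume "e > 0"
  then obtain d where d: "d > 0" "\<And>w. norm (w - z) < d \<Longrightarrow>
      norm (f w - f z - (w - z) \<bullet> g) \<le> e * norm (w - z)"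
    using f unfolding has_derivative_at_alt by meson
  show "\<forall>\<^sub>F w in at z within W. - g \<bullet> (w - z) \<le> e * norm (w - z)"
    unfolding eventually_at
  proof (intro exI[of _ d] conjI ballI impI \<open>d > 0\<close>)
    fix w assume w: "w \<in> W" "w \<noteq> z \<and> dist w z < d"
    then have "norm (f w - f z - (w - z) \<bullet> g) \<le> e * norm (w - z)"
      by (intro d(2)) (simp add: dist_norm)
    with min[OF w(1)] show "- g \<bullet> (w - z) \<le> e * norm (w - z)"
      by (simp add: inner_commute)
  qed
qed

text \<open>A step of length s in the direction of \<open>xs\<close> is matched in the graph by a
  move of length at most l * s in the second component. Testing the normal inequality with this pair
  bounds \<open>norm xs\<close> by \<open>l * norm ys\<close> up to an arbitrarily small
  error.\<close>

lemma regular_normal_Lipschitz_bound: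
  fixes G :: "'x::real_inner \<Rightarrow> 'y::real_inner set"
  assumes N: "(xs, - ys) \<in> regular_normal_cone (x, y) (gph G)" and "r > 0" "l \<ge> 0"
    and lip: "\<And>x'. dist x' x < r \<Longrightarrow> \<exists>y'\<in>G x'. norm (y' - y) \<le> l * norm (x' - x)"
  shows "norm xs \<le> l * norm ys"
proof (cases "xs = 0")
  case False
  define u where "u = xs /\<^sub>R norm xs"
  have u: "norm u = 1" "xs \<bullet> u = norm xs"
    using False by (simp_all add: u_def power2_norm_eq_inner[symmetric] power2_eq_square)
  have "norm xs \<le> l * norm ys + e" if "e > 0" for e
  proof -
    \<comment> \<open>The test displacement has norm at most s * (1 + l); the factor 1 + l is
      compensated here and again in the choice of \<open>s\<close>.\<close>
    define e' where "e' = e / (1 + l)"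
    have e': "e' > 0" "e' * (1 + l) = e" using that \<open>l \<ge> 0\<close> by (simp_all add: e'_def)
    obtain d where d: "d > 0" "\<And>w. w \<in> gph G \<Longrightarrow> w \<noteq> (x, y) \<Longrightarrow> dist w (x, y) < d \<Longrightarrow>
        (xs, - ys) \<bullet> (w - (x, y)) \<le> e' * norm (w - (x, y))"
      using N e'(1) unfolding regular_normal_cone_iff eventually_at by metis
    define s where "s = min (r / 2) (d / (2 * (1 + l)))"
    have s: "s > 0" "s < r" using \<open>r > 0\<close> d(1) \<open>l \<ge> 0\<close> by (auto simp: s_def)
    have "s * (1 + l) \<le> d / (2 * (1 + l)) * (1 + l)"
      using \<open>l \<ge> 0\<close> by (intro mult_right_mono) (auto simp: s_def)
    also have "\<dots> = d / 2" using \<open>l \<ge> 0\<close> by (simp add: field_simps)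
    finally have sd: "s * (1 + l) < d" using d(1) by linarith
    have ns: "norm (s *\<^sub>R u) = s" using s u by simp
    then obtain y' where y': "y' \<in> G (x + s *\<^sub>R u)" "norm (y' - y) \<le> l * s"
      using lip[of "x + s *\<^sub>R u"] s by (auto simp: dist_norm)
    define w where "w = (x + s *\<^sub>R u, y')"
    have wz: "w - (x, y) = (s *\<^sub>R u, y' - y)" by (simp add: w_def)
    have nw: "norm (w - (x, y)) \<le> s * (1 + l)"
      unfolding wz using norm_Pair_le[of "s *\<^sub>R u" "y' - y"] ns y'(2) by (simp add: algebra_simps)
    have "s *\<^sub>R u \<noteq> 0" using ns s by auto
    then have "w \<noteq> (x, y)" by (auto simp: w_def)
    moreover have "w \<in> gph G" using y' by (simp add: w_def gph_def)
    moreover have "dist w (x, y) < d" using nw sd by (simp add: dist_norm)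
    ultimately have "(xs, - ys) \<bullet> (w - (x, y)) \<le> e' * norm (w - (x, y))" using d(2) by blast
    also have "\<dots> \<le> e' * (s * (1 + l))" using nw e' by (intro mult_left_mono) auto
    also have "\<dots> = s * e" using e'(2) by (metis mult.assoc mult.commute)
    finally have "s * norm xs - ys \<bullet> (y' - y) \<le> s * e" by (simp add: wz u)
    moreover have "ys \<bullet> (y' - y) \<le> norm ys * (l * s)"
      by (rule order_trans[OF norm_cauchy_schwarz]) (intro mult_left_mono y'(2), simp)
    ultimately have "s * norm xs \<le> s * (l * norm ys + e)" by (simp add: algebra_simps)
    then show ?thesis using s by simp
  qed
  then show ?thesis by (rule field_le_epsilon)
qed (use \<open>l \<ge> 0\<close> in simp)

text \<open>Limiting normals are limits of regular normals at nearby graph points, so the Lipschitz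
  condition is asked around each of those. It is localized in the second variable, which the example
  on an atom relies on.\<close>

lemma coderivative_Lipschitz_bound:
  fixes G :: "'x::real_inner \<Rightarrow> 'y::real_inner set"
  assumes xs: "xs \<in> coderivative G (x, y) ys" and "r > 0" "l \<ge> 0"
    and lip: "\<And>x' y' x''. y' \<in> G x' \<Longrightarrow> dist x' x < r \<Longrightarrow> dist y' y < r \<Longrightarrow> dist x'' x' < r \<Longrightarrow>
      \<exists>y''\<in>G x''. norm (y'' - y') \<le> l * norm (x'' - x')"
  shows "norm xs \<le> l * norm ys"
proof -
  obtain z zs where z: "z \<longlonglongrightarrow> (x, y)" and zs: "zs \<longlonglongrightarrow> (xs, - ys)"
    and N: "\<And>k::nat. zs k \<in> regular_normal_cone (z k) (gph G)"
    using xs unfolding coderivative_def limiting_normal_cone_def by blast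
  have "\<forall>\<^sub>F k in sequentially. dist (z k) (x, y) < r"
    using z \<open>r > 0\<close> by (rule tendstoD)
  then have "\<forall>\<^sub>F k in sequentially. norm (fst (zs k)) \<le> l * norm (snd (zs k))"
  proof eventually_elim
    case (elim k)
    obtain u v where uv: "z k = (u, v)" by force
    obtain a b where ab: "zs k = (a, b)" by force
    have d: "dist u x < r" "dist v y < r"
      using elim dist_fst_le[of "z k" "(x, y)"] dist_snd_le[of "z k" "(x, y)"] by (auto simp: uv)
    have vG: "v \<in> G u" using N[of k] by (auto simp: regular_normal_cone_iff gph_def uv)
    have "norm a \<le> l * norm (- b)"
    proof (rule regular_normal_Lipschitz_bound[OF _ \<open>r > 0\<close> \<open>l \<ge> 0\<close>])
      show "(a, - (- b)) \<in> regular_normal_cone (u, v) (gph G)" using N[of k] by (simp add: uv ab)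
    qed (rule lip[OF vG d])
    then show ?case by (simp add: ab)
  qed
  moreover have "(\<lambda>k. norm (fst (zs k))) \<longlonglongrightarrow> norm xs"
    using tendsto_norm[OF tendsto_fst[OF zs]] by simp
  moreover have "(\<lambda>k. l * norm (snd (zs k))) \<longlonglongrightarrow> l * norm ys"
    using tendsto_mult_left[OF tendsto_norm[OF tendsto_snd[OF zs]], of l] by simp
  ultimately show ?thesis
    by (intro tendsto_le[OF sequentially_bot, of "\<lambda>k. l * norm (snd (zs k))" _ "\<lambda>k. norm (fst (zs k))"])
qed

text \<open>A penalty centred at \<open>p\<close>, with the x' of the overview as first component.
  The first term is nonsmooth only where \<open>fst z = fst p\<close>, the case that signals no
  violation; the square root is the distance in the second variable, smoothed so as to have a
  gradient at \<open>snd p\<close> too.\<close>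

definition penalty :: "real \<Rightarrow> real \<Rightarrow> 'x::real_inner \<times> 'y::real_inner \<Rightarrow> 'x \<times> 'y \<Rightarrow> real" where
  "penalty l d p z = l * norm (fst z - fst p) + sqrt ((norm (snd z - snd p))\<^sup>2 + d\<^sup>2)"

lemma penalty_has_derivative:
  fixes p z :: "'x::real_inner \<times> 'y::real_inner"
  assumes "fst z \<noteq> fst p" "d > 0"
  shows "(penalty l d p has_derivative (\<lambda>h. h \<bullet> (l *\<^sub>R sgn (fst z - fst p),
    (snd z - snd p) /\<^sub>R sqrt ((norm (snd z - snd p))\<^sup>2 + d\<^sup>2)))) (at z)"
proof -
  have pos: "(norm (snd z - snd p))\<^sup>2 + d\<^sup>2 > 0" using \<open>d > 0\<close> by (intro add_nonneg_pos) auto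
  have fst: "((\<lambda>z. fst z - fst p) has_derivative fst) (at z)"
    by (auto intro!: derivative_eq_intros)
  have 1: "((\<lambda>z. norm (fst z - fst p)) has_derivative (\<lambda>h. fst h \<bullet> sgn (fst z - fst p))) (at z)"
    using has_derivative_compose[OF fst has_derivative_norm] assms by auto
  have 2: "((\<lambda>z. sqrt ((snd z - snd p) \<bullet> (snd z - snd p) + d\<^sup>2)) has_derivative
      (\<lambda>h. snd h \<bullet> (snd z - snd p) / sqrt ((norm (snd z - snd p))\<^sup>2 + d\<^sup>2))) (at z)"
    using pos by (auto intro!: derivative_eq_intros simp: power2_norm_eq_inner inner_commute field_simps)
  have "((\<lambda>z. l * norm (fst z - fst p) + sqrt ((snd z - snd p) \<bullet> (snd z - snd p) + d\<^sup>2)) has_derivative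
      (\<lambda>h. l * (fst h \<bullet> sgn (fst z - fst p)) +
        snd h \<bullet> (snd z - snd p) / sqrt ((norm (snd z - snd p))\<^sup>2 + d\<^sup>2))) (at z)"
    by (intro has_derivative_add has_derivative_mult_right 1 2)
  then show ?thesis
    unfolding penalty_def [abs_def] power2_norm_eq_inner
    by (simp add: inner_prod_def power2_norm_eq_inner divide_inverse mult.commute)
qed

lemma norm_div_sqrt_less_one:
  fixes a :: "'a::real_normed_vector"
  assumes "d > 0"
  shows "norm (a /\<^sub>R sqrt ((norm a)\<^sup>2 + d\<^sup>2)) < 1"
proof -
  have "norm a = sqrt ((norm a)\<^sup>2)" by simp
  also have "\<dots> < sqrt ((norm a)\<^sup>2 + d\<^sup>2)" using assms by (intro real_sqrt_less_mono) simp
  finally have less: "norm a < sqrt ((norm a)\<^sup>2 + d\<^sup>2)" .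
  then have "sqrt ((norm a)\<^sup>2 + d\<^sup>2) > 0" using norm_ge_zero le_less_trans by blast
  with less show ?thesis by (simp add: divide_simps)
qed

text \<open>Fermat's rule with the gradient of \<open>penalty\<close>: its first component has norm
  exactly \<open>l\<close>, its second has norm below 1. A constant sequence turns the regular
  normal into a limiting one.\<close>

lemma penalty_minimizer_coderivative:
  fixes G :: "'x::real_inner \<Rightarrow> 'y::real_inner set"
  assumes v: "v \<in> G u" and min: "\<And>w. w \<in> gph G \<Longrightarrow> penalty l d p (u, v) \<le> penalty l d p w"
    and u: "u \<noteq> fst p" and "d > 0" "l > 0"
  obtains xs where "xs \<in> coderivative G (u, v) ((v - snd p) /\<^sub>R sqrt ((norm (v - snd p))\<^sup>2 + d\<^sup>2))"
    and "l * norm ((v - snd p) /\<^sub>R sqrt ((norm (v - snd p))\<^sup>2 + d\<^sup>2)) < norm xs"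
proof -
  define ys where "ys = (v - snd p) /\<^sub>R sqrt ((norm (v - snd p))\<^sup>2 + d\<^sup>2)"
  have "- (l *\<^sub>R sgn (u - fst p), ys) \<in> regular_normal_cone (u, v) (gph G)"
  proof (rule regular_normal_of_minimizer[where f = "penalty l d p"])
    show "penalty l d p (u, v) \<le> penalty l d p w" if "w \<in> gph G" for w using that by (rule min)
    show "(u, v) \<in> gph G" using v by (simp add: gph_def)
    show "(penalty l d p has_derivative (\<lambda>h. h \<bullet> (l *\<^sub>R sgn (u - fst p), ys))) (at (u, v))"
      using penalty_has_derivative[of "(u, v)" p d l] u \<open>d > 0\<close> by (simp add: ys_def)
  qed
  then have "(- (l *\<^sub>R sgn (u - fst p)), - ys) \<in> limiting_normal_cone (u, v) (gph G)"
    unfolding limiting_normal_cone_def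
    by (intro CollectI exI[of _ "\<lambda>_. (u, v)"] exI[of _ "\<lambda>_. (- (l *\<^sub>R sgn (u - fst p)), - ys)"]) simp
  then have "- (l *\<^sub>R sgn (u - fst p)) \<in> coderivative G (u, v) ys" by (simp add: coderivative_def)
  moreover have "norm ys < 1" unfolding ys_def by (rule norm_div_sqrt_less_one[OF \<open>d > 0\<close>])
  then have "l * norm ys < norm (- (l *\<^sub>R sgn (u - fst p)))"
    using u \<open>l > 0\<close> by (simp add: norm_sgn)
  ultimately show ?thesis using that by (simp add: ys_def)
qed

lemma penalty_attains_min:
  fixes W :: "('x::euclidean_space \<times> 'y::euclidean_space) set"
  assumes "closed W" "w\<^sub>0 \<in> W" "l > 0"
  obtains z where "z \<in> W" "\<And>w. w \<in> W \<Longrightarrow> penalty l d p z \<le> penalty l d p w"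
proof -
  let ?c = "penalty l d p w\<^sub>0"
  define S where "S = W \<inter> {z. penalty l d p z \<le> ?c}"
  have cont: "continuous_on A (penalty l d p)" for A
    unfolding penalty_def by (intro continuous_intros)
  have "closed S" unfolding S_def using assms(1) by (intro closed_Int closed_Collect_le cont continuous_intros)
  moreover have "S \<subseteq> cball (fst p) (?c / l) \<times> cball (snd p) ?c"
  proof
    fix z assume "z \<in> S"
    then have le: "l * norm (fst z - fst p) + sqrt ((norm (snd z - snd p))\<^sup>2 + d\<^sup>2) \<le> ?c"
      by (simp add: S_def penalty_def)
    have "norm (snd z - snd p) \<le> sqrt ((norm (snd z - snd p))\<^sup>2 + d\<^sup>2)" by (rule real_le_rsqrt) simp
    moreover have "0 \<le> l * norm (fst z - fst p)" using \<open>l > 0\<close> by simp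
    ultimately have "l * norm (fst z - fst p) \<le> ?c" "norm (snd z - snd p) \<le> ?c"
      using le norm_ge_zero[of "snd z - snd p"] by linarith+
    then show "z \<in> cball (fst p) (?c / l) \<times> cball (snd p) ?c"
      using \<open>l > 0\<close> by (cases z) (simp add: dist_norm norm_minus_commute field_simps)
  qed
  then have "bounded S" by (rule bounded_subset[rotated]) (intro bounded_Times bounded_cball)
  ultimately have "compact S" by (simp add: compact_eq_bounded_closed)
  moreover have "w\<^sub>0 \<in> S" using assms(2) by (simp add: S_def)
  ultimately obtain z where z: "z \<in> S" "\<And>w. w \<in> S \<Longrightarrow> penalty l d p z \<le> penalty l d p w"
    using continuous_attains_inf[OF _ _ cont, of S] by blast
  have "penalty l d p z \<le> penalty l d p w" if "w \<in> W" for w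
  proof (cases "w \<in> S")
    case False
    then show ?thesis using z(1) that by (auto simp: S_def)
  qed (rule z(2))
  moreover have "z \<in> W" using z(1) by (simp add: S_def)
  ultimately show ?thesis using that by blast
qed

text \<open>For \<open>p\<close> in \<open>D\<close> near \<open>(x', y)\<close> the minimizer turns
  out to lie over \<open>fst p\<close>, hence supplies a value of \<open>G\<close> there. Comparing
  its penalty with that of \<open>(x, y)\<close> gives the Lipschitz estimate up to errors that
  vanish as \<open>p\<close> tends to \<open>(x', y)\<close> and d to 0. The values stay bounded,
  and closedness of the graph yields a value at \<open>x'\<close> itself.\<close>

lemma Lipschitz_of_penalty_minimizers:
  fixes G :: "'x::euclidean_space \<Rightarrow> 'y::euclidean_space set"
  assumes W: "closed (gph G)" and l: "l > 0" and "\<eta> > 0"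
    and D: "\<And>U. open U \<Longrightarrow> U \<noteq> {} \<Longrightarrow> \<exists>p\<in>D. p \<in> U"
    and min: "\<And>p n u v. p \<in> D \<Longrightarrow> v \<in> G u \<Longrightarrow> norm (u - xb) \<le> \<eta> \<Longrightarrow>
      (\<And>w. w \<in> gph G \<Longrightarrow> penalty l (inverse (Suc n)) p (u, v) \<le> penalty l (inverse (Suc n)) p w) \<Longrightarrow>
      u = fst p"
    and x: "norm (x - xb) \<le> \<eta> / 4" and x': "norm (x' - xb) \<le> \<eta> / 4" and y: "y \<in> G x"
  obtains y' where "y' \<in> G x'" "norm (y - y') \<le> l * norm (x - x')"
proof -
  \<comment> \<open>Both \<open>fst p - x'\<close> and, after division by \<open>l\<close>,
    \<open>snd p - y\<close> are thereby kept at norm at most \<eta>/16.\<close>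
  define c where "c = min (\<eta> / 16) (l * \<eta> / 16)"
  have c: "c > 0" using l \<open>\<eta> > 0\<close> by (simp add: c_def)
  let ?d = "\<lambda>n. inverse (real (Suc n))"
  have "\<exists>p v. norm (fst p - x') \<le> c * ?d n \<and> norm (snd p - y) \<le> c * ?d n \<and> v \<in> G (fst p) \<and>
      norm (v - snd p) \<le> l * norm (x - fst p) + norm (y - snd p) + ?d n" for n
  proof -
    have "c * ?d n > 0" using c by simp
    then obtain p where p: "p \<in> D" "p \<in> ball (x', y) (c * ?d n)" using D[of "ball (x', y) (c * ?d n)"] by auto
    have "dist (fst p) x' \<le> dist p (x', y)" "dist (snd p) y \<le> dist p (x', y)"
      using dist_fst_le[of p "(x', y)"] dist_snd_le[of p "(x', y)"] by simp_all
    then have px: "norm (fst p - x') \<le> c * ?d n" and py: "norm (snd p - y) \<le> c * ?d n"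
      using p(2) by (simp_all add: dist_commute dist_norm norm_minus_commute)
    have "(x, y) \<in> gph G" using y by (simp add: gph_def)
    then obtain u v where z: "(u, v) \<in> gph G"
      "\<And>w. w \<in> gph G \<Longrightarrow> penalty l (?d n) p (u, v) \<le> penalty l (?d n) p w"
      using penalty_attains_min[OF W _ l, of "(x, y)" "?d n" p] by (metis surj_pair)
    have "penalty l (?d n) p (u, v) \<le> penalty l (?d n) p (x, y)" using z(2) \<open>(x, y) \<in> gph G\<close> .
    moreover have "sqrt ((norm (y - snd p))\<^sup>2 + (?d n)\<^sup>2) \<le> norm (y - snd p) + ?d n"
      by (rule sqrt_sum_squares_le_sum) auto
    ultimately have est: "l * norm (u - fst p) + sqrt ((norm (v - snd p))\<^sup>2 + (?d n)\<^sup>2)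
        \<le> l * norm (x - fst p) + norm (y - snd p) + ?d n"
      by (simp add: penalty_def)
    \<comment> \<open>The smoothing adds at most d on the right of \<open>est\<close> and at least d
      on the left, so it cancels; no term d / l remains to be controlled.\<close>
    have "?d n \<le> sqrt ((norm (v - snd p))\<^sup>2 + (?d n)\<^sup>2)" by (rule real_le_rsqrt) simp
    with est have "l * norm (u - fst p) \<le> l * norm (x - fst p) + norm (y - snd p)" by linarith
    also have "norm (y - snd p) \<le> l * \<eta> / 16"
    proof -
      have "c * ?d n \<le> c * 1" using c by (intro mult_left_mono) (auto simp: divide_simps)
      then show ?thesis using py by (simp add: c_def norm_minus_commute)
    qed
    finally have "l * norm (u - fst p) \<le> l * (norm (x - fst p) + \<eta> / 16)" by (simp add: algebra_simps)
    then have up: "norm (u - fst p) \<le> norm (x - fst p) + \<eta> / 16" using l by simp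
    have px': "norm (fst p - x') \<le> \<eta> / 16"
    proof -
      have "c * ?d n \<le> c * 1" using c by (intro mult_left_mono) (auto simp: divide_simps)
      then show ?thesis using px by (simp add: c_def)
    qed
    have "norm (u - xb) \<le> norm (u - fst p) + norm (fst p - x') + norm (x' - xb)"
      using norm_triangle_ineq[of "u - fst p" "fst p - x'"] norm_triangle_ineq[of "u - x'" "x' - xb"] by simp
    moreover have "norm (x - fst p) \<le> norm (x - xb) + norm (x' - xb) + norm (fst p - x')"
      using norm_triangle_ineq4[of "x - xb" "x' - xb"] norm_triangle_ineq4[of "x - x'" "fst p - x'"] by simp
    \<comment> \<open>The contributions add up to 15/16 of \<eta>; hence the restriction of
      \<open>x\<close> and \<open>x'\<close> to radius \<eta>/4.\<close>
    ultimately have "norm (u - xb) \<le> \<eta>" using up px' x x' \<open>\<eta> > 0\<close> by linarith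
    moreover have vG: "v \<in> G u" using z(1) by (simp add: gph_def)
    ultimately have "u = fst p" using min[OF p(1)] z(2) by blast
    moreover have "norm (v - snd p) \<le> sqrt ((norm (v - snd p))\<^sup>2 + (?d n)\<^sup>2)" by (rule real_le_rsqrt) simp
    moreover have "0 \<le> l * norm (u - fst p)" using l by simp
    ultimately have "v \<in> G (fst p)" "norm (v - snd p) \<le> l * norm (x - fst p) + norm (y - snd p) + ?d n"
      using est vG by (simp_all only:)
    then show ?thesis using px py by blast
  qed
  then obtain p v where px: "\<And>n. norm (fst (p n) - x') \<le> c * ?d n" and py: "\<And>n. norm (snd (p n) - y) \<le> c * ?d n"
    and vG: "\<And>n. v n \<in> G (fst (p n))"
    and vp: "\<And>n. norm (v n - snd (p n)) \<le> l * norm (x - fst (p n)) + norm (y - snd (p n)) + ?d n"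
    by metis
  have d0: "?d \<longlonglongrightarrow> 0" by (rule LIMSEQ_inverse_real_of_nat)
  have cd0: "(\<lambda>n. c * ?d n) \<longlonglongrightarrow> 0" using tendsto_mult_right_zero[OF d0] .
  have "(\<lambda>n. fst (p n) - x') \<longlonglongrightarrow> 0"
    by (rule Lim_null_comparison[OF _ cd0]) (use px in auto)
  then have plim: "(\<lambda>n. fst (p n)) \<longlonglongrightarrow> x'" by (simp add: LIM_zero_iff)
  have "(\<lambda>n. snd (p n) - y) \<longlonglongrightarrow> 0"
    by (rule Lim_null_comparison[OF _ cd0]) (use py in auto)
  then have qlim: "(\<lambda>n. snd (p n)) \<longlonglongrightarrow> y" by (simp add: LIM_zero_iff)
  let ?R = "\<lambda>n. l * norm (x - fst (p n)) + norm (y - snd (p n)) + ?d n"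
  have Rlim: "?R \<longlonglongrightarrow> l * norm (x - x') + norm (y - y) + 0"
    by (intro tendsto_intros plim qlim d0)
  then have "bounded (range ?R)" by (rule convergent_imp_bounded)
  then obtain B where B: "\<And>n. \<bar>?R n\<bar> \<le> B" unfolding bounded_iff by auto
  have "norm (v n) \<le> B + (norm y + c)" for n
  proof -
    have "norm (v n) \<le> norm (v n - snd (p n)) + (norm (snd (p n) - y) + norm y)"
      using norm_triangle_ineq[of "v n - snd (p n)" "snd (p n)"] norm_triangle_ineq[of "snd (p n) - y" y] by simp
    moreover have "c * ?d n \<le> c * 1" using c by (intro mult_left_mono) (auto simp: divide_simps)
    ultimately show ?thesis using vp[of n] B[of n] py[of n] by linarith
  qed
  then have "bounded (range v)" unfolding bounded_iff by blast
  then obtain y' r where r: "strict_mono r" "(v \<circ> r) \<longlonglongrightarrow> y'"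
    using bounded_imp_convergent_subsequence by blast
  have "((\<lambda>n. fst (p n)) \<circ> r) \<longlonglongrightarrow> x'" using LIMSEQ_subseq_LIMSEQ[OF plim r(1)] .
  then have lim: "(\<lambda>n. (fst (p (r n)), v (r n))) \<longlonglongrightarrow> (x', y')"
    using r(2) by (intro tendsto_Pair) (simp_all add: comp_def)
  have mem: "(fst (p (r n)), v (r n)) \<in> gph G" for n using vG by (simp add: gph_def)
  have "(x', y') \<in> gph G"
    by (rule closed_sequentially[OF W mem lim])
  moreover have "norm (y - y') \<le> l * norm (x - x')"
  proof -
    have "(\<lambda>n. ?R (r n)) \<longlonglongrightarrow> l * norm (x - x')"
      using LIMSEQ_subseq_LIMSEQ[OF Rlim r(1)] by (simp add: comp_def)
    moreover have "(\<lambda>n. norm (v (r n) - snd (p (r n)))) \<longlonglongrightarrow> norm (y' - y)"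
      using LIMSEQ_subseq_LIMSEQ[OF qlim r(1)] r(2) by (intro tendsto_intros) (simp_all add: comp_def)
    ultimately have "norm (y' - y) \<le> l * norm (x - x')"
      using vp by (intro LIMSEQ_le) auto
    then show ?thesis by (simp add: norm_minus_commute)
  qed
  ultimately show ?thesis using that by (simp add: gph_def)
qed

section \<open>Integrable Lipschitzian properties\<close>

lemma nonatomic_half_subset:
  assumes "finite_measure M" "nonatomic M" "A \<in> sets M" "measure M A > 0"
  obtains B where "B \<in> sets M" "B \<subseteq> A" "measure M B > 0" "measure M B \<le> measure M A / 2"
proof -
  interpret finite_measure M by fact
  have "\<not> is_atom M A" using assms by (auto simp: nonatomic_def)
  then obtain B where B: "B \<in> sets M" "B \<subseteq> A" "measure M B < measure M A" "measure M B > 0"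
    using assms by (auto simp: is_atom_def emeasure_eq_measure ennreal_less_iff less_le)
  \<comment> \<open>If \<open>B\<close> has more than half the measure of \<open>A\<close>, the rest
    of \<open>A\<close> has less than half, and still positive measure.\<close>
  have "measure M (A - B) = measure M A - measure M B" using B assms by (intro finite_measure_Diff) auto
  then show ?thesis
    using that[of B] that[of "A - B"] B assms by (cases "measure M B \<le> measure M A / 2") auto
qed

lemma nonatomic_small_subset:
  assumes "finite_measure M" "nonatomic M" "A \<in> sets M" "measure M A > 0" "e > 0"
  obtains B where "B \<in> sets M" "B \<subseteq> A" "measure M B > 0" "measure M B \<le> e"
proof -
  have "\<exists>B\<in>sets M. B \<subseteq> A \<and> measure M B > 0 \<and> measure M B \<le> measure M A / 2 ^ n" for n
  proof (induction n)
    case (Suc n)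
    then obtain B where B: "B \<in> sets M" "B \<subseteq> A" "measure M B > 0" "measure M B \<le> measure M A / 2 ^ n" by blast
    from nonatomic_half_subset[OF assms(1,2) B(1,3)]
    obtain C where "C \<in> sets M" "C \<subseteq> B" "measure M C > 0" "measure M C \<le> measure M B / 2" by blast
    with B show ?case by (intro bexI[of _ C]) auto
  qed (use assms in auto)
  moreover have "(\<lambda>n. measure M A / 2 ^ n) \<longlonglongrightarrow> 0" by (rule LIMSEQ_divide_realpow_zero) simp
  then obtain n where "measure M A / 2 ^ n < e"
    using \<open>e > 0\<close> by (metis (no_types, lifting) eventually_sequentially order_refl order_tendstoD(2))
  ultimately show ?thesis using that by (meson less_imp_le order_trans)
qed

text \<open>Controls the L1 cost of a modification whose size is \<open>g\<close>. A real-valued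
  function is bounded on a part of \<open>A\<close> of positive measure, and that part can then be
  shrunk relative to the bound.\<close>

lemma nonatomic_small_integral_subset:
  fixes g :: "'t \<Rightarrow> real"
  assumes "finite_measure M" "nonatomic M" "A \<in> sets M" "measure M A > 0" "e > 0"
    and g: "g \<in> borel_measurable M"
  obtains B k where "B \<in> sets M" "B \<subseteq> A" "measure M B > 0" "k \<ge> 0" "\<And>t. t \<in> B \<Longrightarrow> g t \<le> k" "k * measure M B \<le> e"
proof -
  interpret finite_measure M by fact
  let ?A = "\<lambda>k::nat. A \<inter> {t \<in> space M. g t \<le> real k}"
  have m: "?A k \<in> sets M" for k using g assms(3) by measurable
  obtain k where k: "measure M (?A k) > 0"
  proof (rule ccontr)
    assume "\<not> thesis"
    then have "emeasure M (?A k) = 0" for k using that[of k] by (auto simp: emeasure_eq_measure zero_less_measure_iff)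
    then have "emeasure M (\<Union>k. ?A k) = 0" using m by (intro emeasure_UN_eq_0) auto
    moreover have "(\<Union>k. ?A k) = A" using sets.sets_into_space[OF assms(3), THEN subsetD] by (auto intro: real_arch_simple)
    ultimately show False using assms(4) by (simp add: measure_def)
  qed
  have "e / (real k + 1) > 0" using \<open>e > 0\<close> by simp
  from nonatomic_small_subset[OF assms(1,2) m k this]
  obtain B where B: "B \<in> sets M" "B \<subseteq> ?A k" "measure M B > 0" "measure M B \<le> e / (real k + 1)" by blast
  have "real k * measure M B \<le> (real k + 1) * measure M B" by (simp add: distrib_right)
  also have "\<dots> \<le> e" using B(4) by (simp add: field_simps)
  finally show ?thesis using that[of B "real k"] B by auto
qed

section \<open>Essential bounds and the implication from Lipschitz to quasi-Lipschitz\<close>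

lemma Linf_norm_le:
  fixes f :: "'t \<Rightarrow> 'a::{second_countable_topology, real_normed_vector}"
  assumes "f \<in> borel_measurable M" "\<And>t. norm (f t) \<le> c"
  shows "Linf_norm M f \<le> ereal c"
  unfolding Linf_norm_def using assms by (intro esssup_I) auto

lemma LinfI:
  fixes f :: "'t \<Rightarrow> 'a::{second_countable_topology, real_normed_vector}"
  assumes "f \<in> borel_measurable M" "\<And>t. norm (f t) \<le> c"
  shows "f \<in> Linf M"
  using assms(1) Linf_norm_le[OF assms] by (auto simp: Linf_def intro: le_less_trans)

lemma AE_Linf_norm_le:
  assumes "Linf_norm M f \<le> ereal c"
  shows "AE t in M. norm (f t) \<le> c"
proof -
  have "AE t in M. ereal (norm (f t)) \<le> Linf_norm M f" unfolding Linf_norm_def by (rule esssup_AE)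
  then show ?thesis using assms by (auto elim!: eventually_mono dest: order_trans)
qed

lemma in_Minkowski_ball_iff:
  fixes S :: "'a::real_normed_vector set"
  assumes "c \<ge> 0"
  shows "v \<in> {y + c *\<^sub>R b | y b. y \<in> S \<and> b \<in> cball 0 1} \<longleftrightarrow> (\<exists>y\<in>S. norm (v - y) \<le> c)"
proof
  assume "v \<in> {y + c *\<^sub>R b | y b. y \<in> S \<and> b \<in> cball 0 1}"
  then obtain y b where "v = y + c *\<^sub>R b" "y \<in> S" "norm b \<le> 1" by auto
  then show "\<exists>y\<in>S. norm (v - y) \<le> c" using assms by (auto intro!: bexI[of _ y] mult_left_le)
next
  assume "\<exists>y\<in>S. norm (v - y) \<le> c"
  then obtain y where y: "y \<in> S" "norm (v - y) \<le> c" by blast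
  have "v = y + c *\<^sub>R ((v - y) /\<^sub>R c)" "norm ((v - y) /\<^sub>R c) \<le> 1"
    using y assms by (cases "c = 0"; simp add: divide_simps)+
  then show "v \<in> {y + c *\<^sub>R b | y b. y \<in> S \<and> b \<in> cball 0 1}" using y(1) by fastforce
qed

lemma Lipschitz_imp_quasi_Lipschitz:
  fixes \<Phi> :: "'t \<Rightarrow> 'x::euclidean_space \<Rightarrow> 'y::euclidean_space set"
  assumes "integrably_locally_Lipschitzian M \<Phi> xb"
  shows "integrably_quasi_Lipschitzian M \<Phi> xb yb"
proof -
  obtain \<eta> l T where \<eta>: "\<eta> > 0" and l: "l \<in> L1_pos M" and T: "T \<in> sets M" "emeasure M (space M - T) = 0"
    and lip: "\<And>t x x'. t \<in> T \<Longrightarrow> x \<in> cball xb \<eta> \<Longrightarrow> x' \<in> cball xb \<eta> \<Longrightarrow>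
      \<Phi> t x \<subseteq> {y + (l t * norm (x - x')) *\<^sub>R b | y b. y \<in> \<Phi> t x' \<and> b \<in> cball 0 1}"
    using assms unfolding integrably_locally_Lipschitzian_def by blast
  have AET: "AE t in M. t \<in> T"
    by (rule AE_I[of _ _ "space M - T"]) (use T in auto)
  have bound: "norm xs \<le> l t * norm (ys t)"
    if t: "t \<in> T" "t \<in> space M" "norm (x t - xb) \<le> \<eta> / 2" and xs: "xs \<in> coderivative (\<Phi> t) (x t, y t) (ys t)"
    for t xs and x :: "'t \<Rightarrow> 'x" and y ys :: "'t \<Rightarrow> 'y"
  proof (rule coderivative_Lipschitz_bound[OF xs])
    \<comment> \<open>Starting within \<eta>/2 of \<open>xb\<close>, two moves of length below
      \<eta>/4 keep \<open>x'\<close> and \<open>x''\<close> in the ball of radius \<eta>.\<close>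
    show "\<eta> / 4 > 0" using \<eta> by simp
    have lt: "l t > 0" using l t(2) by (simp add: L1_pos_def)
    then show "l t \<ge> 0" by simp
    fix x' y' x'' assume y': "y' \<in> \<Phi> t x'" and d: "dist x' (x t) < \<eta> / 4" "dist x'' x' < \<eta> / 4"
    have "dist xb (x t) \<le> \<eta> / 2" using t(3) by (simp add: dist_norm norm_minus_commute)
    moreover have "dist xb x' \<le> dist xb (x t) + dist x' (x t)" by (rule dist_triangle2)
    moreover have "dist xb x'' \<le> dist xb x' + dist x'' x'" by (rule dist_triangle2)
    ultimately have "dist xb x' \<le> \<eta>" "dist xb x'' \<le> \<eta>" using d \<eta> by linarith+
    then have "y' \<in> {y + (l t * norm (x' - x'')) *\<^sub>R b | y b. y \<in> \<Phi> t x'' \<and> b \<in> cball 0 1}"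
      using lip[OF t(1), of x' x''] y' by auto
    then show "\<exists>y''\<in>\<Phi> t x''. norm (y'' - y') \<le> l t * norm (x'' - x')"
      using in_Minkowski_ball_iff[of "l t * norm (x' - x'')" y' "\<Phi> t x''"] lt
      by (simp add: norm_minus_commute)
  qed
  show ?thesis
    unfolding integrably_quasi_Lipschitzian_def
  proof (intro exI[of _ "\<eta> / 2"] conjI bexI[OF _ l] allI impI)
    show "\<eta> / 2 > 0" using \<eta> by simp
    fix x :: "'t \<Rightarrow> 'x" and y ys :: "'t \<Rightarrow> 'y"
    assume "x \<in> Linf M \<and> Linf_norm M (\<lambda>t. x t - xb) \<le> ereal (\<eta> / 2) \<and> integrable M y \<and>
      L1_norm M (\<lambda>t. y t - yb t) \<le> \<eta> / 2 \<and> (AE t in M. y t \<in> \<Phi> t (x t)) \<and> ys \<in> Linf M"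
    then have "AE t in M. norm (x t - xb) \<le> \<eta> / 2" by (intro AE_Linf_norm_le) auto
    with AET AE_space show "AE t in M. (SUP xs\<in>coderivative (\<Phi> t) (x t, y t) (ys t). ereal (norm xs))
        \<le> ereal (l t * norm (ys t))"
    proof eventually_elim
      case (elim t)
      show ?case by (rule SUP_least) (use bound[of t x _ y ys] elim in simp)
    qed
  qed
qed

section \<open>Violating minimizers and the converse implication\<close>

lemma penalty_measurable:
  fixes p :: "'x::euclidean_space \<times> 'y::euclidean_space"
  assumes [measurable]: "l \<in> borel_measurable M"
  shows "(\<lambda>tz. penalty (l (fst tz)) d p (snd tz)) \<in> borel_measurable (M \<Otimes>\<^sub>M borel)"
proof -
  have "(\<lambda>z. norm (fst z - fst p)) \<in> borel_measurable borel" "(\<lambda>z. (norm (snd z - snd p))\<^sup>2) \<in> borel_measurable borel"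
    by (intro borel_measurable_continuous_onI continuous_intros)+
  then have [measurable]: "(\<lambda>tz. norm (fst (snd tz) - fst p)) \<in> borel_measurable (M \<Otimes>\<^sub>M borel)"
    "(\<lambda>tz. (norm (snd (snd tz) - snd p))\<^sup>2) \<in> borel_measurable (M \<Otimes>\<^sub>M borel)"
    by (auto intro: measurable_compose[OF measurable_snd])
  show ?thesis unfolding penalty_def by measurable
qed

definition bad_minimizers ::
    "'t measure \<Rightarrow> ('t \<Rightarrow> 'x::euclidean_space \<Rightarrow> 'y::euclidean_space set) \<Rightarrow> ('t \<Rightarrow> real) \<Rightarrow> 'x \<Rightarrow> real
      \<Rightarrow> real \<Rightarrow> 'x \<times> 'y \<Rightarrow> ('t \<times> 'x \<times> 'y) set" where
  "bad_minimizers M \<Phi> l xb \<eta> d p = {(t, z). t \<in> space M \<and> z \<in> gph (\<Phi> t) \<and>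
     (\<forall>w\<in>gph (\<Phi> t). penalty (l t) d p z \<le> penalty (l t) d p w) \<and> norm (fst z - xb) \<le> \<eta> \<and> fst z \<noteq> fst p}"

text \<open>Points having a competitor of strictly smaller penalty are collected in \<open>N\<close>
  by a rational level \<open>a\<close> between the two values: \<open>Q a\<close> projects a
  product-measurable set and is therefore measurable.\<close>

lemma bad_minimizers_measurable:
  fixes \<Phi> :: "'t \<Rightarrow> 'x::euclidean_space \<Rightarrow> 'y::euclidean_space set"
  assumes M: "finite_measure M" "complete_measure M" and \<Phi>: "set_valued_normal_integrand M \<Phi>"
    and l: "l \<in> borel_measurable M"
  shows "bad_minimizers M \<Phi> l xb \<eta> d p \<in> sets (M \<Otimes>\<^sub>M borel)"
proof -
  let ?B = "M \<Otimes>\<^sub>M (borel :: ('x \<times> 'y) measure)"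
  let ?f = "\<lambda>tz. penalty (l (fst tz)) d p (snd tz)"
  note [measurable] = penalty_measurable[OF l, of d p]
  define W where "W = {(t, x, y). t \<in> space M \<and> y \<in> \<Phi> t x}"
  have W[measurable]: "W \<in> sets ?B"
    using \<Phi> by (simp add: set_valued_normal_integrand_def W_def)
  define Q where "Q a = fst ` (W \<inter> {tz \<in> space ?B. ?f tz < a})" for a
  have Q[measurable]: "Q a \<in> sets M" for a
    unfolding Q_def by (rule measurable_projection[OF M]) measurable
  define N where "N = (\<Union>a\<in>\<rat>. (Q a \<times> UNIV) \<inter> {tz \<in> space ?B. a \<le> ?f tz})"
  have N: "N \<in> sets ?B"
  proof -
    have "(Q a \<times> UNIV) \<inter> {tz \<in> space ?B. a \<le> ?f tz} \<in> sets ?B" for a by measurable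
    then show ?thesis unfolding N_def by (intro sets.countable_UN' countable_rat) auto
  qed
  have "closed {z :: 'x \<times> 'y. norm (fst z - xb) \<le> \<eta>}" "open {z :: 'x \<times> 'y. fst z \<noteq> fst p}"
    by (intro closed_Collect_le open_Collect_neq continuous_intros)+
  then have R: "{z :: 'x \<times> 'y. norm (fst z - xb) \<le> \<eta>} \<inter> {z. fst z \<noteq> fst p} \<in> sets borel"
    by (intro sets.Int) auto
  have "bad_minimizers M \<Phi> l xb \<eta> d p =
      W \<inter> (space M \<times> ({z. norm (fst z - xb) \<le> \<eta>} \<inter> {z. fst z \<noteq> fst p})) - N"
  proof (intro set_eqI)
    fix tz :: "'t \<times> 'x \<times> 'y"
    obtain t z where tz: "tz = (t, z)" by (rule prod.exhaust)
    have "(t, z) \<in> N \<longleftrightarrow> (\<exists>w\<in>gph (\<Phi> t). penalty (l t) d p w < penalty (l t) d p z)" if "t \<in> space M"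
    proof
      assume "(t, z) \<in> N"
      then obtain a where "t \<in> Q a" "a \<le> penalty (l t) d p z" by (auto simp: N_def)
      moreover obtain w where "w \<in> gph (\<Phi> t)" "penalty (l t) d p w < a"
        using \<open>t \<in> Q a\<close> by (auto simp: Q_def W_def gph_def)
      ultimately show "\<exists>w\<in>gph (\<Phi> t). penalty (l t) d p w < penalty (l t) d p z" by force
    next
      assume "\<exists>w\<in>gph (\<Phi> t). penalty (l t) d p w < penalty (l t) d p z"
      then obtain w where w: "w \<in> gph (\<Phi> t)" "penalty (l t) d p w < penalty (l t) d p z" by blast
      then obtain a where a: "a \<in> \<rat>" "penalty (l t) d p w < a" "a < penalty (l t) d p z"
        using Rats_dense_in_real by blast
      have "(t, w) \<in> W \<inter> {tz \<in> space ?B. ?f tz < a}"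
        using w(1) a(2) that by (auto simp: W_def gph_def space_pair_measure)
      from imageI[OF this, of fst] have "t \<in> Q a" by (simp add: Q_def)
      then show "(t, z) \<in> N" using a that by (auto simp: N_def space_pair_measure)
    qed
    then show "tz \<in> bad_minimizers M \<Phi> l xb \<eta> d p \<longleftrightarrow>
        tz \<in> W \<inter> (space M \<times> ({z. norm (fst z - xb) \<le> \<eta>} \<inter> {z. fst z \<noteq> fst p})) - N"
      by (cases "t \<in> space M") (auto simp: tz bad_minimizers_def W_def gph_def not_less)
  qed
  also have "\<dots> \<in> sets ?B" using N R W by (intro sets.Diff sets.Int) auto
  finally show ?thesis .
qed

text \<open>Otherwise minimizers are selected on a set of positive measure, which is shrunk to a set
  \<open>B\<close> where replacing \<open>yb\<close> costs at most \<eta> in L1; elsewhere the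
  reference pair \<open>(xb, yb)\<close> is kept. The modified pair is admissible, yet the
  coderivative estimate fails at every point of \<open>B\<close>, which is not null.\<close>

lemma bad_minimizers_negligible:
  fixes \<Phi> :: "'t \<Rightarrow> 'x::euclidean_space \<Rightarrow> 'y::euclidean_space set"
  assumes M: "finite_measure M" "complete_measure M" "nonatomic M"
    and \<Phi>: "set_valued_normal_integrand M \<Phi>" and l: "l \<in> L1_pos M"
    and yb: "integrable M yb" "AE t in M. yb t \<in> \<Phi> t xb" and "\<eta> > 0" "d > 0"
    and quasi: "\<And>x y ys. x \<in> Linf M \<Longrightarrow> Linf_norm M (\<lambda>t. x t - xb) \<le> ereal \<eta> \<Longrightarrow>
        integrable M y \<Longrightarrow> L1_norm M (\<lambda>t. y t - yb t) \<le> \<eta> \<Longrightarrow>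
        AE t in M. y t \<in> \<Phi> t (x t) \<Longrightarrow> ys \<in> Linf M \<Longrightarrow>
        AE t in M. (SUP xs\<in>coderivative (\<Phi> t) (x t, y t) (ys t). ereal (norm xs)) \<le> ereal (l t * norm (ys t))"
  shows "emeasure M (fst ` bad_minimizers M \<Phi> l xb \<eta> d p) = 0"
proof (rule ccontr)
  interpret finite_measure M by fact
  let ?S = "bad_minimizers M \<Phi> l xb \<eta> d p"
  assume "emeasure M (fst ` ?S) \<noteq> 0"
  then have pos: "emeasure M (fst ` ?S) > 0" by (simp add: zero_less_iff_neq_zero)
  have lm: "l \<in> borel_measurable M" using l by (auto simp: L1_pos_def)
  obtain A f where A: "A \<in> sets M" "emeasure M A > 0" and f[measurable]: "f \<in> borel_measurable M"
    and fS: "\<And>t. t \<in> A \<Longrightarrow> (t, f t) \<in> ?S"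
    using measurable_selection[OF M(1,2) bad_minimizers_measurable[OF M(1,2) \<Phi> lm] pos] by metis
  have um[measurable]: "(\<lambda>t. fst (f t)) \<in> borel_measurable M" and vm[measurable]: "(\<lambda>t. snd (f t)) \<in> borel_measurable M"
    by (auto intro!: measurable_compose[OF f] borel_measurable_continuous_onI continuous_intros)
  have ybm[measurable]: "yb \<in> borel_measurable M" using yb(1) by auto
  have "measure M A > 0" using A(2) by (simp add: emeasure_eq_measure)
  moreover have "(\<lambda>t. norm (snd (f t) - yb t)) \<in> borel_measurable M" by measurable
  ultimately obtain B k where B[measurable]: "B \<in> sets M" and BA: "B \<subseteq> A" and Bpos: "measure M B > 0" and k: "k \<ge> 0"
    "\<And>t. t \<in> B \<Longrightarrow> norm (snd (f t) - yb t) \<le> k" "k * measure M B \<le> \<eta>"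
    using nonatomic_small_integral_subset[OF M(1,3) A(1) _ \<open>\<eta> > 0\<close>, where g = "\<lambda>t. norm (snd (f t) - yb t)"] by metis
  have S: "t \<in> space M" "snd (f t) \<in> \<Phi> t (fst (f t))" "norm (fst (f t) - xb) \<le> \<eta>" "fst (f t) \<noteq> fst p"
    "\<And>w. w \<in> gph (\<Phi> t) \<Longrightarrow> penalty (l t) d p (f t) \<le> penalty (l t) d p w" if "t \<in> B" for t
    using fS[of t] BA that by (auto simp: bad_minimizers_def gph_def case_prod_unfold)
  define x where "x t = (if t \<in> B then fst (f t) else xb)" for t
  define y where "y t = (if t \<in> B then snd (f t) else yb t)" for t
  define q where "q t = (snd (f t) - snd p) /\<^sub>R sqrt ((norm (snd (f t) - snd p))\<^sup>2 + d\<^sup>2)" for t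
  \<comment> \<open>The gradient of the smoothed distance serves as dual function; its norm is at
    most 1, so it is essentially bounded.\<close>
  define ys where "ys t = (if t \<in> B then q t else 0)" for t
  have xm[measurable]: "x \<in> borel_measurable M" unfolding x_def by measurable
  have ysm[measurable]: "ys \<in> borel_measurable M" unfolding ys_def q_def by measurable
  have xn: "norm (x t - xb) \<le> \<eta>" for t using S(3) \<open>\<eta> > 0\<close> by (simp add: x_def)
  have q1: "norm (q t) \<le> 1" for t unfolding q_def using norm_div_sqrt_less_one[OF \<open>d > 0\<close>] less_imp_le by blast
  have y_eq: "y t = yb t + indicator B t *\<^sub>R (snd (f t) - yb t)" for t by (simp add: y_def)
  have yd: "norm (indicator B t *\<^sub>R (snd (f t) - yb t)) \<le> k * indicator B t" for t
    using k(2)[of t] by (simp add: indicator_def)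
  have "norm (indicator B t *\<^sub>R (snd (f t) - yb t)) \<le> k" for t
    using k(1) k(2)[of t] by (simp add: indicator_def)
  then have i: "integrable M (\<lambda>t. indicator B t *\<^sub>R (snd (f t) - yb t))"
    by (intro integrable_const_bound[where B = k]) (simp, measurable)
  have "AE t in M. (SUP xs\<in>coderivative (\<Phi> t) (x t, y t) (ys t). ereal (norm xs)) \<le> ereal (l t * norm (ys t))"
  proof (rule quasi)
    show "x \<in> Linf M"
    proof (rule LinfI[OF xm])
      show "norm (x t) \<le> \<eta> + norm xb" for t using xn[of t] norm_triangle_sub[of "x t" xb] by linarith
    qed
    show "Linf_norm M (\<lambda>t. x t - xb) \<le> ereal \<eta>" by (rule Linf_norm_le) (measurable, rule xn)
    show "integrable M y" unfolding y_eq[abs_def] using yb(1) i by (rule Bochner_Integration.integrable_add)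
    have "L1_norm M (\<lambda>t. y t - yb t) = (\<integral>t. norm (indicator B t *\<^sub>R (snd (f t) - yb t)) \<partial>M)"
      by (simp add: L1_norm_def y_eq)
    also have "\<dots> \<le> (\<integral>t. k * indicator B t \<partial>M)"
      by (rule integral_mono[OF integrable_norm[OF i] _ yd]) (simp add: emeasure_eq_measure)
    also have "\<dots> \<le> \<eta>" using k(3) by simp
    finally show "L1_norm M (\<lambda>t. y t - yb t) \<le> \<eta>" .
    show "AE t in M. y t \<in> \<Phi> t (x t)" using yb(2) by eventually_elim (use S(2) in \<open>auto simp: x_def y_def\<close>)
    show "ys \<in> Linf M" by (rule LinfI[OF ysm, of 1]) (use q1 in \<open>simp add: ys_def\<close>)
  qed
  then have "AE t in M. t \<notin> B"
  proof eventually_elim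
    case (elim t)
    show ?case
    proof
      assume t: "t \<in> B"
      have lt: "l t > 0" using l S(1)[OF t] by (simp add: L1_pos_def)
      have "\<And>w. w \<in> gph (\<Phi> t) \<Longrightarrow> penalty (l t) d p (fst (f t), snd (f t)) \<le> penalty (l t) d p w"
        using S(5)[OF t] by simp
      from penalty_minimizer_coderivative[where l = "l t" and d = d and p = p and G = "\<Phi> t"
        and u = "fst (f t)" and v = "snd (f t)", OF S(2)[OF t] this S(4)[OF t] \<open>d > 0\<close> lt]
      obtain xs where xs: "xs \<in> coderivative (\<Phi> t) (fst (f t), snd (f t)) (q t)" "l t * norm (q t) < norm xs"
        unfolding q_def by blast
      have "ereal (norm xs) \<le> (SUP xs\<in>coderivative (\<Phi> t) (x t, y t) (ys t). ereal (norm xs))"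
        using xs(1) t by (intro SUP_upper) (simp add: x_def y_def ys_def)
      also note elim
      finally show False using xs(2) t by (simp add: ys_def)
    qed
  qed
  then have "emeasure M B = 0" using AE_iff_measurable[where P = "\<lambda>t. t \<notin> B", OF B] sets.sets_into_space[OF B] by auto
  then show False using Bpos by (simp add: emeasure_eq_measure)
qed

text \<open>Each pair of a point \<open>p\<close> of a countable dense set and an index n has its
  own exceptional null set. Off their union no violating minimizer exists for any parameter, and the
  pointwise criterion gives the Lipschitz inclusion with the same \<open>l\<close> on radius
  \<eta>/4.\<close>

lemma quasi_Lipschitz_imp_Lipschitz:
  fixes \<Phi> :: "'t \<Rightarrow> 'x::euclidean_space \<Rightarrow> 'y::euclidean_space set"
  assumes M: "finite_measure M" "complete_measure M" "nonatomic M"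
    and \<Phi>: "set_valued_normal_integrand M \<Phi>"
    and yb: "integrable M yb" "AE t in M. yb t \<in> \<Phi> t xb"
    and quasi: "integrably_quasi_Lipschitzian M \<Phi> xb yb"
  shows "integrably_locally_Lipschitzian M \<Phi> xb"
proof -
  obtain \<eta> l where \<eta>: "\<eta> > 0" and l: "l \<in> L1_pos M" and Q: "\<And>x y ys. x \<in> Linf M \<Longrightarrow>
        Linf_norm M (\<lambda>t. x t - xb) \<le> ereal \<eta> \<Longrightarrow>
        integrable M y \<Longrightarrow> L1_norm M (\<lambda>t. y t - yb t) \<le> \<eta> \<Longrightarrow>
        AE t in M. y t \<in> \<Phi> t (x t) \<Longrightarrow> ys \<in> Linf M \<Longrightarrow>
        AE t in M. (SUP xs\<in>coderivative (\<Phi> t) (x t, y t) (ys t). ereal (norm xs)) \<le> ereal (l t * norm (ys t))"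
    using quasi unfolding integrably_quasi_Lipschitzian_def by blast
  obtain D :: "('x \<times> 'y) set" where D: "countable D" "\<And>U. open U \<Longrightarrow> U \<noteq> {} \<Longrightarrow> \<exists>p\<in>D. p \<in> U"
    using countable_dense_setE by blast
  have lm: "l \<in> borel_measurable M" using l by (auto simp: L1_pos_def)
  let ?S = "\<lambda>p n. bad_minimizers M \<Phi> l xb \<eta> (inverse (real (Suc n))) p"
  have "AE t in M. t \<notin> fst ` ?S p n" for p n
  proof (rule AE_not_in)
    have "fst ` ?S p n \<in> sets M"
      by (rule measurable_projection[OF M(1,2) bad_minimizers_measurable[OF M(1,2) \<Phi> lm]])
    moreover have "emeasure M (fst ` ?S p n) = 0"
      by (rule bad_minimizers_negligible[OF M \<Phi> l yb \<eta> _ Q]) auto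
    ultimately show "fst ` ?S p n \<in> null_sets M" by blast
  qed
  then have "AE t in M. \<forall>p\<in>D. \<forall>n. t \<notin> fst ` ?S p n"
    by (simp add: AE_ball_countable[OF D(1)] AE_all_countable)
  then obtain N where N: "{t \<in> space M. \<not> (\<forall>p\<in>D. \<forall>n. t \<notin> fst ` ?S p n)} \<subseteq> N" "emeasure M N = 0" "N \<in> sets M"
    by (rule AE_E)
  show ?thesis
    unfolding integrably_locally_Lipschitzian_def
  proof (intro exI[of _ "\<eta> / 4"] conjI bexI[OF _ l] bexI[of _ "space M - N"] ballI subsetI)
    show "\<eta> / 4 > 0" using \<eta> by simp
    show "emeasure M (space M - (space M - N)) = 0"
      using N(2) sets.sets_into_space[OF N(3)] by (simp add: double_diff)
    show "space M - N \<in> sets M" using N(3) by blast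
    fix t x x' y assume t: "t \<in> space M - N" and x: "x \<in> cball xb (\<eta> / 4)" "x' \<in> cball xb (\<eta> / 4)" and y: "y \<in> \<Phi> t x"
    have nbad: "(t, z) \<notin> ?S p n" if "p \<in> D" for p n z
    proof
      assume "(t, z) \<in> ?S p n"
      then have "t \<in> fst ` ?S p n" by (metis fst_conv imageI)
      then show False using N(1) t that by blast
    qed
    have lt: "l t > 0" using l t by (simp add: L1_pos_def)
    have "closed (gph (\<Phi> t))" using \<Phi> t by (simp add: set_valued_normal_integrand_def)
    then obtain y' where "y' \<in> \<Phi> t x'" "norm (y - y') \<le> l t * norm (x - x')"
    proof (rule Lipschitz_of_penalty_minimizers[OF _ lt \<eta> D(2), where x = x and x' = x' and y = y and xb = xb])
      fix p n u v
      assume p: "p \<in> D" and "v \<in> \<Phi> t u" "norm (u - xb) \<le> \<eta>"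
        "\<And>w. w \<in> gph (\<Phi> t) \<Longrightarrow> penalty (l t) (inverse (real (Suc n))) p (u, v) \<le> penalty (l t) (inverse (real (Suc n))) p w"
      then show "u = fst p"
        using nbad[OF p, of "(u, v)" n] t by (auto simp: bad_minimizers_def gph_def)
    qed (use x y in \<open>auto simp: dist_norm norm_minus_commute\<close>)
    then show "y \<in> {y + (l t * norm (x - x')) *\<^sub>R b | y b. y \<in> \<Phi> t x' \<and> b \<in> cball 0 1}"
      by (subst in_Minkowski_ball_iff) (use lt in auto)
  qed
qed

text \<open>A selection close to 0 in L1 takes the value \<open>e\<close> on less than the full
  measure of the atom, hence only on a null set. Almost everywhere the coderivative is then taken at
  a graph point with second component 0, near which the graph is flat. The isolated value
  \<open>e\<close> at x = 0 escapes this test but not the Lipschitz inclusion.\<close>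

lemma atom_counterexample:
  fixes M :: "'t measure"
  assumes "finite_measure M" and A: "is_atom M A"
  obtains \<Phi> :: "'t \<Rightarrow> 'x::euclidean_space \<Rightarrow> 'y::euclidean_space set"
  where "set_valued_normal_integrand M \<Phi>" "\<And>t x. 0 \<in> \<Phi> t x"
    "integrably_quasi_Lipschitzian M \<Phi> 0 (\<lambda>_. 0)" "\<not> integrably_locally_Lipschitzian M \<Phi> 0"
proof -
  interpret finite_measure M by fact
  have AM[measurable]: "A \<in> sets M" and Apos: "measure M A > 0"
    and atom: "\<And>B. B \<in> sets M \<Longrightarrow> B \<subseteq> A \<Longrightarrow> measure M B < measure M A \<Longrightarrow> measure M B = 0"
    using A by (auto simp: is_atom_def emeasure_eq_measure ennreal_less_iff)
  obtain e :: 'y where e: "norm e = 1" using vector_choose_size[of 1] by auto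
  obtain u :: 'x where u: "norm u = 1" using vector_choose_size[of 1] by auto
  define \<Phi> :: "'t \<Rightarrow> 'x \<Rightarrow> 'y set" where "\<Phi> t x = (if t \<in> A \<and> x = 0 then {0, e} else {0})" for t x
  have gph: "gph (\<Phi> t) = UNIV \<times> {0} \<union> (if t \<in> A then {(0, e)} else {})" for t
    by (auto simp: gph_def \<Phi>_def split: if_splits)
  have "closed (gph (\<Phi> t))" for t
    unfolding gph by (auto intro!: closed_insert closed_Times)
  moreover have "{(t, x, y). t \<in> space M \<and> y \<in> \<Phi> t x} = space M \<times> (UNIV \<times> {0}) \<union> A \<times> {(0, e)}"
    using sets.sets_into_space[OF AM] by (auto simp: \<Phi>_def split: if_splits)
  moreover have "(UNIV :: 'x set) \<times> {0 :: 'y} \<in> sets borel"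
    by (intro borel_closed closed_Times) auto
  ultimately have 1: "set_valued_normal_integrand M \<Phi>"
    by (auto simp: set_valued_normal_integrand_def intro!: sets.Un pair_measureI)
  have 2: "0 \<in> \<Phi> t x" for t x by (simp add: \<Phi>_def)
  have 3: "integrably_quasi_Lipschitzian M \<Phi> 0 (\<lambda>_. 0)"
    unfolding integrably_quasi_Lipschitzian_def
  \<comment> \<open>The value \<open>e\<close> on almost all of \<open>A\<close> would force an L1
    norm of at least \<open>measure M A\<close>; half of that excludes it. Near second component 0
    the modulus 1 is more than enough.\<close>
  proof (intro exI[of _ "measure M A / 2"] conjI bexI[of _ "\<lambda>_. 1"] allI impI)
    show "measure M A / 2 > 0" using Apos by simp
    show "(\<lambda>_. 1) \<in> L1_pos M" by (simp add: L1_pos_def)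
    fix x :: "'t \<Rightarrow> 'x" and y ys :: "'t \<Rightarrow> 'y"
    assume "x \<in> Linf M \<and> Linf_norm M (\<lambda>t. x t - 0) \<le> ereal (measure M A / 2) \<and> integrable M y \<and>
      L1_norm M (\<lambda>t. y t - 0) \<le> measure M A / 2 \<and> (AE t in M. y t \<in> \<Phi> t (x t)) \<and> ys \<in> Linf M"
    then have y: "integrable M y" "(\<integral>t. norm (y t) \<partial>M) \<le> measure M A / 2" "AE t in M. y t \<in> \<Phi> t (x t)"
      by (auto simp: L1_norm_def)
    have [measurable]: "y \<in> borel_measurable M" using y(1) by auto
    define E where "E = A \<inter> {t \<in> space M. y t = e}"
    have E[measurable]: "E \<in> sets M" unfolding E_def by measurable
    have "measure M E = (\<integral>t. indicator E t \<partial>M)" by simp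
    also have "\<dots> \<le> (\<integral>t. norm (y t) \<partial>M)"
    proof (rule integral_mono)
      show "integrable M (indicator E :: 't \<Rightarrow> real)" by (simp add: emeasure_eq_measure)
      show "integrable M (\<lambda>t. norm (y t))" using y(1) by (rule integrable_norm)
    qed (use e in \<open>auto simp: E_def indicator_def\<close>)
    also have "\<dots> < measure M A" using y(2) Apos by linarith
    finally have "measure M E = 0" by (intro atom) (auto simp: E_def)
    then have "AE t in M. t \<notin> E" by (intro AE_not_in) (auto simp: emeasure_eq_measure)
    with y(3) AE_space have "AE t in M. y t = 0"
      by eventually_elim (auto simp: \<Phi>_def E_def split: if_splits)
    then show "AE t in M. (SUP xs\<in>coderivative (\<Phi> t) (x t, y t) (ys t). ereal (norm xs)) \<le> ereal (1 * norm (ys t))"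
    proof eventually_elim
      case (elim t)
      have "norm xs \<le> 1 * norm (ys t)" if "xs \<in> coderivative (\<Phi> t) (x t, y t) (ys t)" for xs
      \<comment> \<open>Radius 1 separates 0 from \<open>e\<close>, which has norm 1, so only the
        value 0 occurs nearby.\<close>
      proof (rule coderivative_Lipschitz_bound[OF that, of 1])
        fix x' y' x'' assume "y' \<in> \<Phi> t x'" "dist y' (y t) < 1"
        then have "y' = 0" using e elim by (auto simp: \<Phi>_def split: if_splits)
        then show "\<exists>y''\<in>\<Phi> t x''. norm (y'' - y') \<le> 1 * norm (x'' - x')" using 2 by (intro bexI[of _ 0]) auto
      qed auto
      then show ?case by (intro SUP_least) simp
    qed
  qed
  have 4: "\<not> integrably_locally_Lipschitzian M \<Phi> 0"
  proof
    assume "integrably_locally_Lipschitzian M \<Phi> 0"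
    then obtain \<eta> l T where \<eta>: "\<eta> > 0" and l: "l \<in> L1_pos M" and T: "T \<in> sets M" "emeasure M (space M - T) = 0"
      and lip: "\<And>t x x'. t \<in> T \<Longrightarrow> x \<in> cball 0 \<eta> \<Longrightarrow> x' \<in> cball 0 \<eta> \<Longrightarrow>
        \<Phi> t x \<subseteq> {y + (l t * norm (x - x')) *\<^sub>R b | y b. y \<in> \<Phi> t x' \<and> b \<in> cball 0 1}"
      unfolding integrably_locally_Lipschitzian_def by blast
    obtain t where t: "t \<in> A" "t \<in> T"
    proof (rule ccontr)
      assume "\<not> thesis"
      then have "A \<subseteq> space M - T" using that sets.sets_into_space[OF AM] by blast
      then have "emeasure M A \<le> emeasure M (space M - T)" using T by (intro emeasure_mono) auto
      then show False using T Apos by (simp add: emeasure_eq_measure)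
    qed
    have lt: "l t > 0" using l t(1) sets.sets_into_space[OF AM] by (auto simp: L1_pos_def)
    \<comment> \<open>With this shift the inclusion would allow \<open>e\<close> a distance of at
      most 1/2 from \<open>\<Phi> t (s *\<^sub>R u)\<close>, whose only element 0 is at distance
      1.\<close>
    define s where "s = min \<eta> (1 / (2 * l t))"
    have s: "s > 0" "s \<le> \<eta>" "l t * s \<le> 1 / 2"
    proof -
      have "l t * s \<le> l t * (1 / (2 * l t))" using lt by (intro mult_left_mono) (auto simp: s_def)
      then show "l t * s \<le> 1 / 2" using lt by simp
    qed (use \<eta> lt in \<open>auto simp: s_def\<close>)
    have ns: "norm (s *\<^sub>R u) = s" using s u by simp
    then have "s *\<^sub>R u \<noteq> 0" using s(1) by auto
    then have z: "\<Phi> t (s *\<^sub>R u) = {0}" by (simp add: \<Phi>_def)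
    have "e \<in> \<Phi> t 0" using t by (simp add: \<Phi>_def)
    then have "e \<in> {y + (l t * norm (0 - s *\<^sub>R u)) *\<^sub>R b | y b. y \<in> \<Phi> t (s *\<^sub>R u) \<and> b \<in> cball 0 1}"
      using lip[OF t(2), of 0 "s *\<^sub>R u"] \<eta> ns s(2) by auto
    then have "norm e \<le> l t * norm (0 - s *\<^sub>R u)"
      by (subst (asm) in_Minkowski_ball_iff) (use lt z in auto)
    then show False using e ns s(3) by simp
  qed
  show ?thesis by (rule that[OF 1 2 3 4])
qed

theorem theorem4p8:
  fixes M :: "'t measure"
  assumes "finite_measure M" and "complete_measure M"
  shows "(nonatomic M \<longrightarrow>
           (\<forall>(\<Phi> :: 't \<Rightarrow> real ^ 'n \<Rightarrow> (real ^ 'm) set) xb yv yb.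
              set_valued_normal_integrand M \<Phi> \<and>
              (xb, yv) \<in> gph (aumann_integral M \<Phi>) \<and>
              yb \<in> integrable_selections M \<Phi> xb yv \<longrightarrow>
              (integrably_quasi_Lipschitzian M \<Phi> xb yb
                 \<longleftrightarrow> integrably_locally_Lipschitzian M \<Phi> xb)))
       \<and> ((\<exists>A. is_atom M A) \<longrightarrow>
           (\<exists>(\<Phi> :: 't \<Rightarrow> real ^ 'n \<Rightarrow> (real ^ 'm) set) xb yv yb.
              set_valued_normal_integrand M \<Phi> \<and>
              (xb, yv) \<in> gph (aumann_integral M \<Phi>) \<and>
              yb \<in> integrable_selections M \<Phi> xb yv \<and>
              integrably_quasi_Lipschitzian M \<Phi> xb yb \<and>
              \<not> integrably_locally_Lipschitzian M \<Phi> xb))"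
proof (intro conjI impI allI)
  fix \<Phi> :: "'t \<Rightarrow> real ^ 'n \<Rightarrow> (real ^ 'm) set" and xb yv yb
  assume "nonatomic M"
    and h: "set_valued_normal_integrand M \<Phi> \<and> (xb, yv) \<in> gph (aumann_integral M \<Phi>) \<and>
      yb \<in> integrable_selections M \<Phi> xb yv"
  then have "integrable M yb" "AE t in M. yb t \<in> \<Phi> t xb" by (auto simp: integrable_selections_def)
  with h \<open>nonatomic M\<close> assms
  show "integrably_quasi_Lipschitzian M \<Phi> xb yb \<longleftrightarrow> integrably_locally_Lipschitzian M \<Phi> xb"
    using quasi_Lipschitz_imp_Lipschitz Lipschitz_imp_quasi_Lipschitz by blast
next
  assume "\<exists>A. is_atom M A"
  then obtain A where "is_atom M A" by blast
  then obtain \<Phi> :: "'t \<Rightarrow> real ^ 'n \<Rightarrow> (real ^ 'm) set"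
    where \<Phi>: "set_valued_normal_integrand M \<Phi>" "\<And>t x. 0 \<in> \<Phi> t x"
      "integrably_quasi_Lipschitzian M \<Phi> 0 (\<lambda>_. 0)" "\<not> integrably_locally_Lipschitzian M \<Phi> 0"
    using atom_counterexample[OF assms(1)] by metis
  have "(0, 0) \<in> gph (aumann_integral M \<Phi>)"
    using \<Phi>(2) by (auto simp: gph_def aumann_integral_def intro!: exI[of _ "\<lambda>_. 0"])
  moreover have "(\<lambda>_. 0) \<in> integrable_selections M \<Phi> 0 0"
    using \<Phi>(2) by (simp add: integrable_selections_def)
  ultimately show "\<exists>(\<Phi> :: 't \<Rightarrow> real ^ 'n \<Rightarrow> (real ^ 'm) set) xb yv yb.
      set_valued_normal_integrand M \<Phi> \<and> (xb, yv) \<in> gph (aumann_integral M \<Phi>) \<and>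
      yb \<in> integrable_selections M \<Phi> xb yv \<and> integrably_quasi_Lipschitzian M \<Phi> xb yb \<and>
      \<not> integrably_locally_Lipschitzian M \<Phi> xb"
    using \<Phi>(1,3,4) by blast
qed

end
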